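(* Let $R$ be a unital ring and $N$ a finite totally ordered set. Let $D$ be a cochain complex of $R$-modules with differential $d$. Let $h_k\colon D\to D$, $k\in N$, be a collection of pairwise commuting cochain maps. Let $C$ be another cochain complex of $R$-modules, with differential denoted by $d$ as well, and let $\alpha\colon C\to D$ and $\beta\colon D\to C$ be cochain maps. Suppose that $G$ is a homotopy from $\mathrm{id}_D$ to $\alpha\circ\beta$, so that $d\circ G+G\circ d=\alpha\circ\beta-\mathrm{id}_D$. Then $C$, $d$ and the following data define a special $N$-cube: - $f_k=\beta\circ h_k\circ\alpha$, for $k\in N$; - $H_{\{k<\ell\}}=\beta\circ(h_kGh_\ell-h_\ell Gh_k)\circ\alpha$, for $\{k<\ell\}\subseteq N$; - $H_S=\beta\circ\Big(\sum_{\sigma\in\Sigma(S)}\mathrm{sgn}(\sigma)\,h_{\sigma(z_1)}Gh_{\sigma(z_2)}Gh_{\sigma(z_3)}\cdots Gh_{\sigma(z_s)}\Big)\circ\alpha$, for every set $S=\{z_1<z_2<\dots<z_s\}\subseteq N$ with $s\ge3$. Here $\Sigma(S)$ is the group of permutations of $S$.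
   Context: Subsets $A,B,S\subseteq N$ have cardinalities $a,b,s$. Complexes are cochain complexes (differentials raise degree); $G$ is a map of graded modules of degree $-1$. Total incidence numbers: for $B=\{b_1<\dots<b_b\}\subseteq N$ write $d_i(B)=B\setminus\{b_i\}$. For $A\subset B$ there is a unique way to write $A=d_{i_1}d_{i_2}\cdots d_{i_{b-a}}(B)$ with $i_1<\dots<i_{b-a}$; set $[B:A]=(-1)^{b-a}(-1)^{i_1+\dots+i_{b-a}}$, $[A:A]=1$, and $[B:A]=0$ if $A\not\subseteq B$. An $N$-diagram $F$ consists of a graded $R$-module $F(A)$ for each $A\subseteq N$ and a graded module homomorphism $H_{B,A}\colon F(A)\to F(B)$ of degree $a-b+1$ for each $A\subseteq B$ (no compatibility conditions). Its totalisation is the graded module $\mathrm{Tot}(F)^\ell=\bigoplus_{A\subseteq N}F(A)^{\ell-a}$ together with the maps $D(F)=(D_{B,A})_{A,B\subseteq N}\colon\mathrm{Tot}(F)^\ell\to\mathrm{Tot}(F)^{\ell+1}$, where $D_{B,A}=(-1)^{ab}[B:A]\cdot H_{B,A}$ if $A\subseteq B$ and $D_{B,A}=0$ otherwise. $F$ is a homotopy commutative $N$-cube if $D(F)\circ D(F)=0$. An $N$-diagram is special if $F(A)=C$ does not depend on $A$ and $H_{B,A}$ depends only on $B\setminus A$. It is specified by the graded module $C$, a map $d$ (equal to $H_{A,A}$ for all $A$), maps $f_k$ ($k\in N$; equal to $H_{B,A}$ if $B\setminus A=\{k\}$), and maps $H_S$ of degree $1-s$ for $S\subseteq N$, $s\ge2$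 (equal to $H_{B,A}$ if $B\setminus A=S$). A special $N$-cube is a special $N$-diagram which is also a homotopy commutative $N$-cube. *)

theory Defs
  imports "HOL-Algebra.Module" "HOL-Combinatorics.Permutations"
begin

text \<open>
  The library locale \<^locale>\<open>module\<close> requires a commutative ring of scalars. The following
  is the same list of axioms over an arbitrary unital ring. As for the library modules, the
  multiplicative fields of the record carry no meaning.
\<close>

locale left_module = R?: ring + M?: abelian_group M for M (structure) +
  assumes smult_closed [simp, intro]:
      "\<lbrakk>a \<in> carrier R; x \<in> carrier M\<rbrakk> \<Longrightarrow> a \<odot>\<^bsub>M\<^esub> x \<in> carrier M"
    and smult_l_distr:
      "\<lbrakk>a \<in> carrier R; b \<in> carrier R; x \<in> carrier M\<rbrakk> \<Longrightarrow>
       (a \<oplus> b) \<odot>\<^bsub>M\<^esub> x = a \<odot>\<^bsub>M\<^esub> x \<oplus>\<^bsub>M\<^esub> b \<odot>\<^bsub>M\<^esub> x"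
    and smult_r_distr:
      "\<lbrakk>a \<in> carrier R; x \<in> carrier M; y \<in> carrier M\<rbrakk> \<Longrightarrow>
       a \<odot>\<^bsub>M\<^esub> (x \<oplus>\<^bsub>M\<^esub> y) = a \<odot>\<^bsub>M\<^esub> x \<oplus>\<^bsub>M\<^esub> a \<odot>\<^bsub>M\<^esub> y"
    and smult_assoc1:
      "\<lbrakk>a \<in> carrier R; b \<in> carrier R; x \<in> carrier M\<rbrakk> \<Longrightarrow>
       (a \<otimes> b) \<odot>\<^bsub>M\<^esub> x = a \<odot>\<^bsub>M\<^esub> (b \<odot>\<^bsub>M\<^esub> x)"
    and smult_one [simp]:
      "x \<in> carrier M \<Longrightarrow> \<one> \<odot>\<^bsub>M\<^esub> x = x"

definition left_module_hom ::
  "('r, 'z) ring_scheme \<Rightarrow> ('r, 'a) module \<Rightarrow> ('r, 'b) module \<Rightarrow> ('a \<Rightarrow> 'b) set" where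
  "left_module_hom R M M' = {f \<in> carrier M \<rightarrow> carrier M'.
     (\<forall>x\<in>carrier M. \<forall>y\<in>carrier M. f (x \<oplus>\<^bsub>M\<^esub> y) = f x \<oplus>\<^bsub>M'\<^esub> f y) \<and>
     (\<forall>r\<in>carrier R. \<forall>x\<in>carrier M. f (r \<odot>\<^bsub>M\<^esub> x) = r \<odot>\<^bsub>M'\<^esub> f x)}"

text \<open>
  A graded module is a family of modules indexed by the integers. A map \<open>f\<close> of graded modules
  of degree \<open>k\<close> is a family with \<open>f i\<close> mapping degree \<open>i\<close> to degree \<open>i + k\<close>.
\<close>

type_synonym ('r, 'a) graded_module = "int \<Rightarrow> ('r, 'a) module"

type_synonym ('a, 'b) graded_map = "int \<Rightarrow> 'a \<Rightarrow> 'b"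

definition is_graded_module ::
  "('r, 'z) ring_scheme \<Rightarrow> ('r, 'a) graded_module \<Rightarrow> bool" where
  "is_graded_module R C \<longleftrightarrow> (\<forall>i. left_module R (C i))"

definition graded_hom ::
  "('r, 'z) ring_scheme \<Rightarrow> int \<Rightarrow> ('r, 'a) graded_module \<Rightarrow> ('r, 'b) graded_module
     \<Rightarrow> ('a, 'b) graded_map \<Rightarrow> bool" where
  "graded_hom R k C D f \<longleftrightarrow> (\<forall>i. f i \<in> left_module_hom R (C i) (D (i + k)))"

definition cochain_complex ::
  "('r, 'z) ring_scheme \<Rightarrow> ('r, 'a) graded_module \<Rightarrow> ('a, 'a) graded_map \<Rightarrow> bool" where
  "cochain_complex R C d \<longleftrightarrow> is_graded_module R C \<and> graded_hom R 1 C C d \<and>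
     (\<forall>i. \<forall>x\<in>carrier (C i). d (i + 1) (d i x) = \<zero>\<^bsub>C (i + 2)\<^esub>)"

definition cochain_map ::
  "('r, 'z) ring_scheme \<Rightarrow> ('r, 'a) graded_module \<Rightarrow> ('a, 'a) graded_map
     \<Rightarrow> ('r, 'b) graded_module \<Rightarrow> ('b, 'b) graded_map \<Rightarrow> ('a, 'b) graded_map \<Rightarrow> bool" where
  "cochain_map R C dC D dD f \<longleftrightarrow> graded_hom R 0 C D f \<and>
     (\<forall>i. \<forall>x\<in>carrier (C i). f (i + 1) (dC i x) = dD i (f i x))"

definition cochain_homotopy ::
  "('r, 'z) ring_scheme \<Rightarrow> ('r, 'a) graded_module \<Rightarrow> ('a, 'a) graded_map
     \<Rightarrow> ('r, 'b) graded_module \<Rightarrow> ('b, 'b) graded_map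
     \<Rightarrow> ('a, 'b) graded_map \<Rightarrow> ('a, 'b) graded_map \<Rightarrow> ('a, 'b) graded_map \<Rightarrow> bool" where
  "cochain_homotopy R C dC D dD f g G \<longleftrightarrow> graded_hom R (-1) C D G \<and>
     (\<forall>i. \<forall>x\<in>carrier (C i).
        dD (i - 1) (G i x) \<oplus>\<^bsub>D i\<^esub> G (i + 1) (dC i x) = g i x \<ominus>\<^bsub>D i\<^esub> f i x)"

text \<open>Indices of faces start at \<open>1\<close>.\<close>

definition face :: "nat \<Rightarrow> 'n::linorder set \<Rightarrow> 'n set" where
  "face i B = B - {sorted_list_of_set B ! (i - 1)}"

text \<open>
  The index lists \<open>[i\<^sub>1, \<dots>, i\<^sub>m]\<close> with \<open>i\<^sub>1 < \<dots> < i\<^sub>m\<close> and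
  \<open>A = face i\<^sub>1 (\<dots> (face i\<^sub>m B))\<close>. The face with the largest index is taken first, so the
  constraint that each index lies in range reduces to a constraint in terms of \<open>B\<close>.
\<close>

definition is_face_list :: "'n::linorder set \<Rightarrow> 'n set \<Rightarrow> nat list \<Rightarrow> bool" where
  "is_face_list B A is \<longleftrightarrow> sorted_wrt (<) is \<and> set is \<subseteq> {1..card B} \<and> foldr face is B = A"

definition incidence :: "'n::linorder set \<Rightarrow> 'n set \<Rightarrow> int" where
  "incidence B A =
     (if A \<subset> B then (-1) ^ (card B - card A) * (-1) ^ sum_list (THE is. is_face_list B A is)
      else if A = B then 1 else 0)"

lemma foldr_face:
  fixes B :: "'n::linorder set"
  assumes "finite B" "sorted_wrt (<) is" "set is \<subseteq> {1..card B}"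
  shows "foldr face is B = B - (\<lambda>i. sorted_list_of_set B ! (i - 1)) ` set is"
  using assms(2,3)
proof (induction "is")
  case Nil
  then show ?case by simp
next
  case (Cons i "is")
  let ?L = "sorted_list_of_set B"
  let ?X = "(\<lambda>i. ?L ! (i - 1)) ` set is"
  have IH: "foldr face is B = B - ?X" using Cons by simp
  have i: "1 \<le> i" "i \<le> card B" using Cons.prems by auto
  have len: "length ?L = card B" by simp
  have "?L ! m \<notin> ?X" if "m < i" for m
  proof
    assume "?L ! m \<in> ?X"
    then obtain j where j: "j \<in> set is" "?L ! m = ?L ! (j - 1)" by auto
    have "i < j" "j \<le> card B" using j(1) Cons.prems by auto
    then have "m = j - 1"
      using nth_eq_iff_index_eq[of ?L m "j - 1"] j(2) that i by simp
    with \<open>i < j\<close> that show False by simp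
  qed
  then have "x \<notin> ?X" if "x \<in> set (take i ?L)" for x
    using that unfolding in_set_conv_nth by fastforce
  then have "filter (\<lambda>x. x \<notin> ?X) (take i ?L) = take i ?L"
    by (simp only: filter_id_conv) blast
  then have "filter (\<lambda>x. x \<notin> ?X) ?L = take i ?L @ filter (\<lambda>x. x \<notin> ?X) (drop i ?L)"
    by (metis append_take_drop_id filter_append)
  moreover have "filter (\<lambda>x. x \<notin> ?X) ?L = sorted_list_of_set (B - ?X)"
  proof (rule sorted_distinct_set_unique)
    show "set (filter (\<lambda>x. x \<notin> ?X) ?L) = set (sorted_list_of_set (B - ?X))"
      using assms(1) by auto
  qed (auto simp: sorted_wrt_filter)
  ultimately have "sorted_list_of_set (B - ?X) = take i ?L @ filter (\<lambda>x. x \<notin> ?X) (drop i ?L)"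
    by (simp only:)
  moreover have "(take i ?L @ ys) ! (i - 1) = ?L ! (i - 1)" for ys
    using i by (simp add: nth_append)
  ultimately have "sorted_list_of_set (B - ?X) ! (i - 1) = ?L ! (i - 1)"
    by (simp only:)
  then have "face i (B - ?X) = B - ?X - {?L ! (i - 1)}"
    by (simp only: face_def)
  then show ?case unfolding foldr.simps comp_apply IH by auto
qed

lemma is_face_list_ex1:
  fixes B :: "'n::linorder set"
  assumes "finite B" "A \<subseteq> B"
  shows "\<exists>!is. is_face_list B A is"
proof -
  define b where "b = (\<lambda>i. sorted_list_of_set B ! (i - 1))"
  define I where "I = {i \<in> {1..card B}. b i \<notin> A}"
  have "bij_betw (\<lambda>i. i - 1) {1..card B} {..<card B}"
    by (rule bij_betw_byWitness[where f' = Suc]) auto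
  moreover have "bij_betw ((!) (sorted_list_of_set B)) {..<card B} B"
    using bij_betw_nth[of "sorted_list_of_set B" "{..<card B}" B] assms(1) by simp
  ultimately have "bij_betw b {1..card B} B"
    using bij_betw_trans unfolding b_def by (fastforce simp: comp_def)
  then have inj: "inj_on b {1..card B}" and im: "b ` {1..card B} = B"
    by (simp_all add: bij_betw_def)
  have J: "B - b ` J = A \<longleftrightarrow> J = I" if "J \<subseteq> {1..card B}" for J
  proof -
    have mem: "b i \<in> b ` J \<longleftrightarrow> i \<in> J" if "i \<in> {1..card B}" for i
      using inj_on_image_mem_iff[OF inj that \<open>J \<subseteq> _\<close>] .
    have "B - b ` J = A \<longleftrightarrow> (\<forall>i\<in>{1..card B}. b i \<notin> b ` J \<longleftrightarrow> b i \<in> A)"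
    proof -
      have "B - b ` J = A \<longleftrightarrow> (\<forall>x\<in>B. x \<notin> b ` J \<longleftrightarrow> x \<in> A)"
        using assms(2) by blast
      also have "\<dots> \<longleftrightarrow> (\<forall>x\<in>b ` {1..card B}. x \<notin> b ` J \<longleftrightarrow> x \<in> A)"
        by (simp only: im)
      finally show ?thesis by (simp only: ball_simps)
    qed
    also have "\<dots> \<longleftrightarrow> (\<forall>i\<in>{1..card B}. i \<in> J \<longleftrightarrow> b i \<notin> A)"
      using mem by blast
    also have "\<dots> \<longleftrightarrow> J = I"
      using that unfolding I_def by blast
    finally show ?thesis .
  qed
  have iff: "is_face_list B A is \<longleftrightarrow> sorted_wrt (<) is \<and> set is = I" for "is"
  proof -
    have "I \<subseteq> {1..card B}" unfolding I_def by blast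
    then show ?thesis
      unfolding is_face_list_def
      using foldr_face[OF assms(1), of "is", folded b_def] J[of "set is"] by metis
  qed
  have "finite I" unfolding I_def by simp
  show ?thesis
  proof
    show "is_face_list B A (sorted_list_of_set I)"
      unfolding iff using \<open>finite I\<close> by simp
    show "is = sorted_list_of_set I" if "is_face_list B A is" for "is"
      using that unfolding iff
      by (metis sorted_list_of_set.idem_if_sorted_distinct strict_sorted_iff)
  qed
qed

text \<open>
  For an \<open>N\<close>-diagram, \<open>F A i\<close> is the degree \<open>i\<close> part of the graded module at \<open>A\<close>, and \<open>H B A\<close>
  is the map from the module at \<open>A\<close> to the module at \<open>B\<close>.
\<close>

definition N_diagram ::
  "('r, 'z) ring_scheme \<Rightarrow> 'n set \<Rightarrow> ('n set \<Rightarrow> ('r, 'c) graded_module)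
     \<Rightarrow> ('n set \<Rightarrow> 'n set \<Rightarrow> ('c, 'c) graded_map) \<Rightarrow> bool" where
  "N_diagram R N F H \<longleftrightarrow>
     (\<forall>A. A \<subseteq> N \<longrightarrow> is_graded_module R (F A)) \<and>
     (\<forall>A B. A \<subseteq> B \<and> B \<subseteq> N \<longrightarrow>
        graded_hom R (int (card A) - int (card B) + 1) (F A) (F B) (H B A))"

text \<open>
  The index set \<open>Pow N\<close> is finite for the finite sets \<open>N\<close> considered here, so the direct sum
  is the set of all extensional families.
\<close>

definition Tot ::
  "'n set \<Rightarrow> ('n set \<Rightarrow> ('r, 'c) graded_module) \<Rightarrow> ('r, 'n set \<Rightarrow> 'c) graded_module" where
  "Tot N F l =
     \<lparr>carrier = (\<Pi>\<^sub>E A\<in>Pow N. carrier (F A (l - int (card A)))),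
      monoid.mult = undefined, one = undefined,
      zero = (\<lambda>A\<in>Pow N. \<zero>\<^bsub>F A (l - int (card A))\<^esub>),
      add = (\<lambda>v w. \<lambda>A\<in>Pow N. v A \<oplus>\<^bsub>F A (l - int (card A))\<^esub> w A),
      smult = (\<lambda>r v. \<lambda>A\<in>Pow N. r \<odot>\<^bsub>F A (l - int (card A))\<^esub> v A)\<rparr>"

text \<open>
  The matrix entry \<open>D\<^sub>B\<^sub>,\<^sub>A\<close> out of \<open>Tot\<close> in degree \<open>l\<close>: it maps the summand
  \<open>F A (l - card A)\<close> to \<open>F B (l + 1 - card B)\<close>.
\<close>

definition Tot_entry ::
  "('n::linorder set \<Rightarrow> ('r, 'c) graded_module) \<Rightarrow> ('n set \<Rightarrow> 'n set \<Rightarrow> ('c, 'c) graded_map)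
     \<Rightarrow> 'n set \<Rightarrow> 'n set \<Rightarrow> ('c, 'c) graded_map" where
  "Tot_entry F H B A l x =
     (if A \<subseteq> B
      then [((-1) ^ (card A * card B) * incidence B A)] \<cdot>\<^bsub>F B (l + 1 - int (card B))\<^esub>
             H B A (l - int (card A)) x
      else \<zero>\<^bsub>F B (l + 1 - int (card B))\<^esub>)"

definition Tot_diff ::
  "'n::linorder set \<Rightarrow> ('n set \<Rightarrow> ('r, 'c) graded_module)
     \<Rightarrow> ('n set \<Rightarrow> 'n set \<Rightarrow> ('c, 'c) graded_map)
     \<Rightarrow> ('n set \<Rightarrow> 'c, 'n set \<Rightarrow> 'c) graded_map" where
  "Tot_diff N F H l v =
     (\<lambda>B\<in>Pow N. \<Oplus>\<^bsub>F B (l + 1 - int (card B))\<^esub>A\<in>Pow N. Tot_entry F H B A l (v A))"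

definition homotopy_commutative_cube ::
  "('r, 'z) ring_scheme \<Rightarrow> 'n::linorder set \<Rightarrow> ('n set \<Rightarrow> ('r, 'c) graded_module)
     \<Rightarrow> ('n set \<Rightarrow> 'n set \<Rightarrow> ('c, 'c) graded_map) \<Rightarrow> bool" where
  "homotopy_commutative_cube R N F H \<longleftrightarrow> N_diagram R N F H \<and>
     (\<forall>l. \<forall>v\<in>carrier (Tot N F l).
        Tot_diff N F H (l + 1) (Tot_diff N F H l v) = \<zero>\<^bsub>Tot N F (l + 2)\<^esub>)"

definition special_N_diagram ::
  "('r, 'z) ring_scheme \<Rightarrow> 'n set \<Rightarrow> ('n set \<Rightarrow> ('r, 'c) graded_module)
     \<Rightarrow> ('n set \<Rightarrow> 'n set \<Rightarrow> ('c, 'c) graded_map) \<Rightarrow> bool" where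
  "special_N_diagram R N F H \<longleftrightarrow> N_diagram R N F H \<and>
     (\<forall>A A'. A \<subseteq> N \<and> A' \<subseteq> N \<longrightarrow> F A = F A') \<and>
     (\<forall>A B A' B'. A \<subseteq> B \<and> B \<subseteq> N \<and> A' \<subseteq> B' \<and> B' \<subseteq> N \<and> B - A = B' - A' \<longrightarrow>
        (\<forall>i. \<forall>x\<in>carrier (F A i). H B A i x = H B' A' i x))"

definition special_N_cube ::
  "('r, 'z) ring_scheme \<Rightarrow> 'n::linorder set \<Rightarrow> ('n set \<Rightarrow> ('r, 'c) graded_module)
     \<Rightarrow> ('n set \<Rightarrow> 'n set \<Rightarrow> ('c, 'c) graded_map) \<Rightarrow> bool" where
  "special_N_cube R N F H \<longleftrightarrow> special_N_diagram R N F H \<and> homotopy_commutative_cube R N F H"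

text \<open>The structure maps of the special diagram specified by \<open>d\<close>, \<open>f\<close> and \<open>H\<close>.\<close>

definition special_maps ::
  "('c, 'c) graded_map \<Rightarrow> ('n \<Rightarrow> ('c, 'c) graded_map) \<Rightarrow> ('n set \<Rightarrow> ('c, 'c) graded_map)
     \<Rightarrow> 'n set \<Rightarrow> 'n set \<Rightarrow> ('c, 'c) graded_map" where
  "special_maps d f H B A =
     (if B - A = {} then d
      else if card (B - A) = 1 then f (the_elem (B - A))
      else H (B - A))"

text \<open>
  The composite \<open>h k\<^sub>1 \<circ> G \<circ> h k\<^sub>2 \<circ> G \<circ> \<dots> \<circ> G \<circ> h k\<^sub>s\<close>, of degree \<open>1 - s\<close>. In the recursive
  equation \<open>ks\<close> has length \<open>s - 1\<close>, so the composite for \<open>ks\<close> lands in degree \<open>i + 1 - length ks\<close>.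
  Only nonempty lists are meaningful.
\<close>

fun hG_word ::
  "('n \<Rightarrow> ('a, 'a) graded_map) \<Rightarrow> ('a, 'a) graded_map \<Rightarrow> 'n list \<Rightarrow> ('a, 'a) graded_map" where
  "hG_word h G [] i x = undefined"
| "hG_word h G [k] i x = h k i x"
| "hG_word h G (k # ks) i x =
     h k (i - int (length ks)) (G (i + 1 - int (length ks)) (hG_word h G ks i x))"

end

theory Submission
  imports Defs "HOL-Algebra.AbelCoset" "HOL-Combinatorics.Multiset_Permutations"
begin

text \<open>
  Write \<open>W(k\<^sub>1, \<dots>, k\<^sub>s) = h\<^bsub>k\<^sub>1\<^esub> G h\<^bsub>k\<^sub>2\<^esub> G \<dots> G h\<^bsub>k\<^sub>s\<^esub>\<close>. Moving \<open>d\<close> through such a word, each letter \<open>G\<close>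
  in turn is replaced by \<open>d G + G d = \<alpha> \<beta> - id\<close>. In the antisymmetrisation over all orderings of \<open>S\<close>
  the words with \<open>id\<close> cancel in pairs, since they contain two adjacent commuting letters, and the
  words with \<open>\<alpha> \<beta>\<close> factor as \<open>W(us) \<alpha> \<beta> W(ts)\<close> with \<open>us @ ts\<close> an ordering of \<open>S\<close>. Grouping the latter
  by \<open>T = set ts\<close> expresses the graded commutator of \<open>d\<close> and \<open>H\<^sub>S\<close> by the composites
  \<open>H\<^bsub>S - T\<^esub> H\<^sub>T\<close>, up to the sign of the shuffle. Both this sign and the incidence numbers are products
  of the signs \<open>inv_sign X Y\<close> counting the inversions between two sets, so the relation obtained is
  the vanishing of the matrix entries of \<open>D(F)\<^sup>2\<close>.
\<close>

section \<open>Inversions and incidence numbers\<close>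

text \<open>In the entry of \<open>D(F)^2\<close> from \<open>A\<close> to \<open>B\<close>, put
  \<open>S = B - A\<close> and write an intermediate set as \<open>M = A \<union> T\<close> with
  \<open>T \<subseteq> S\<close>. The sign of that summand splits into a factor that depends on
  \<open>A\<close> and \<open>B\<close> alone and the factor
  \<open>(-1)^(|S||T|) * inv_sign T (S - T)\<close>. So all entries with the same \<open>S\<close>
  reduce to a single relation, in which \<open>d\<close> is treated as the map indexed by the empty
  set; the summands \<open>T = {}\<close> and \<open>T = S\<close> are then the two halves of the
  graded commutator. Moving \<open>d\<close> through words produces a different sign,
  \<open>(-1)^|T| * inv_sign (S - T) T\<close>: the first factor counts the letters to the right of
  the cut, the second is the shuffle sign. The two signs agree because
  \<open>inv_sign X Y * inv_sign Y X = (-1)^(|X||Y|)\<close> for disjoint sets and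
  \<open>|T|^2\<close> has the parity of \<open>|T|\<close>. Orderings of \<open>S\<close> are kept
  as lists, since a list can be cut in two and a permutation of \<open>S\<close> cannot. All maps
  are specified on carriers only and degree by degree, which is why most facts come with membership
  and degree equations.\<close>

definition inv_sign :: "'n::linorder set \<Rightarrow> 'n set \<Rightarrow> int" where
  "inv_sign X Y = (\<Prod>x\<in>X. \<Prod>y\<in>Y. if y < x then -1 else 1)"

lemma inv_sign_Un_left:
  assumes "finite X" "finite X'" "X \<inter> X' = {}"
  shows "inv_sign (X \<union> X') Y = inv_sign X Y * inv_sign X' Y"
  using assms by (simp add: inv_sign_def prod.union_disjoint)

lemma inv_sign_Un_right:
  assumes "finite Y" "finite Y'" "Y \<inter> Y' = {}"
  shows "inv_sign X (Y \<union> Y') = inv_sign X Y * inv_sign X Y'"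
  using assms by (simp add: inv_sign_def prod.union_disjoint prod.distrib)

lemma inv_sign_empty [simp]: "inv_sign {} Y = 1" "inv_sign X {} = 1"
  by (simp_all add: inv_sign_def)

lemma inv_sign_square [simp]: "inv_sign X Y * inv_sign X Y = 1"
proof -
  have "inv_sign X Y * inv_sign X Y =
      (\<Prod>x\<in>X. \<Prod>y\<in>Y. (if y < x then -1 else 1) * (if y < x then -1 else 1))"
    by (simp only: inv_sign_def prod.distrib)
  also have "\<dots> = 1"
    by (intro prod.neutral ballI) simp
  finally show ?thesis .
qed

text \<open>For disjoint sets each pair \<open>(x, y)\<close> is an inversion in exactly one of the
  two directions, so each of the \<open>card X * card Y\<close> pairs contributes one factor
  -1.\<close>

lemma inv_sign_swap:
  assumes "finite X" "finite Y" "X \<inter> Y = {}"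
  shows "inv_sign X Y * inv_sign Y X = (-1) ^ (card X * card Y)"
proof -
  have "inv_sign Y X = (\<Prod>x\<in>X. \<Prod>y\<in>Y. if x < y then -1 else 1)"
    unfolding inv_sign_def by (rule prod.swap)
  then have "inv_sign X Y * inv_sign Y X =
      (\<Prod>x\<in>X. \<Prod>y\<in>Y. (if y < x then -1 else 1) * (if x < y then -1 else 1))"
    by (simp only: inv_sign_def prod.distrib)
  also have "\<dots> = (\<Prod>x\<in>X. \<Prod>y\<in>Y. -1)"
    using assms(3) by (intro prod.cong refl) auto
  also have "\<dots> = (-1) ^ (card X * card Y)"
    by (simp add: power_mult[symmetric] mult.commute)
  finally show ?thesis .
qed

text \<open>Translates the index of a face into a number of smaller elements, which is what
  \<open>inv_sign\<close> counts.\<close>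

lemma card_less_nth_sorted_list_of_set:
  assumes "finite B" "n < card B"
  shows "card {y \<in> B. y < sorted_list_of_set B ! n} = n"
proof -
  let ?L = "sorted_list_of_set B"
  have sorted: "sorted_wrt (<) ?L" by simp
  have less: "?L ! m < ?L ! n \<longleftrightarrow> m < n" if "m < card B" for m
    using sorted_wrt_nth_less[OF sorted, of m n] sorted_wrt_nth_less[OF sorted, of n m]
      assms that by (cases m n rule: linorder_cases) auto
  have "{y \<in> B. y < ?L ! n} = {y \<in> set ?L. y < ?L ! n}"
    using assms(1) by simp
  also have "set ?L = (!) ?L ` {..<card B}"
    using nth_image[of "card B" ?L] by (simp add: atLeast0LessThan)
  also have "{y \<in> (!) ?L ` {..<card B}. y < ?L ! n} = (!) ?L ` {..<n}"
    using less assms(2) by force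
  finally show ?thesis
    using assms by (simp add: card_image inj_on_def nth_eq_iff_index_eq)
qed

text \<open>The face with the largest index is removed first, so every index in the list is a
  position in the original \<open>B\<close>. The sign in \<open>incidence\<close> is therefore the
  product of \<open>(-1)^(i - 1)\<close> over these indices, and \<open>i - 1\<close> is the number
  of elements of \<open>B\<close> below the removed one.\<close>

lemma incidence_eq_inv_sign:
  assumes "finite B" "A \<subseteq> B"
  shows "incidence B A = inv_sign (B - A) B"
proof (cases "A = B")
  case True
  then show ?thesis by (simp add: incidence_def)
next
  case False
  let ?b = "\<lambda>i. sorted_list_of_set B ! (i - 1)"
  define js where "js = (THE is. is_face_list B A is)"
  have "is_face_list B A js"
    unfolding js_def using is_face_list_ex1[OF assms] by (rule theI')
  then have js: "sorted_wrt (<) js" "set js \<subseteq> {1..card B}" and "foldr face js B = A"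
    by (simp_all add: is_face_list_def)
  then have "B - ?b ` set js = A"
    using foldr_face[OF assms(1)] by simp
  moreover have "?b ` set js \<subseteq> B"
  proof
    fix x assume "x \<in> ?b ` set js"
    then obtain i where i: "i \<in> set js" "x = ?b i" by auto
    then have "i - 1 < length (sorted_list_of_set B)" using js(2) by force
    then have "x \<in> set (sorted_list_of_set B)" using i(2) nth_mem by blast
    then show "x \<in> B" using assms(1) by simp
  qed
  ultimately have im: "?b ` set js = B - A" by blast
  \<comment> \<open>The subtraction in \<open>i - 1\<close> truncates at 0, so recovering
    \<open>i\<close> from it uses that all indices are at least 1.\<close>
  have inj: "inj_on ?b (set js)"
  proof (rule inj_onI)
    fix i j assume "i \<in> set js" "j \<in> set js" and eq: "?b i = ?b j"
    then have "i \<in> {1..card B}" "j \<in> {1..card B}" using js(2) by blast+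
    moreover from this have "i - 1 = j - 1"
      using nth_eq_iff_index_eq[of "sorted_list_of_set B" "i - 1" "j - 1"] eq
      by (simp add: Suc_le_eq less_le_trans[OF diff_less])
    ultimately show "i = j" by auto
  qed
  have "inv_sign (B - A) B = (\<Prod>x\<in>B - A. (-1) ^ card {y \<in> B. y < x})"
    unfolding inv_sign_def using assms(1)
    by (intro prod.cong refl) (simp add: prod.If_cases Int_def)
  also have "\<dots> = (\<Prod>i\<in>set js. (-1) ^ card {y \<in> B. y < ?b i})"
    by (simp only: im[symmetric] prod.reindex[OF inj] o_def)
  \<comment> \<open>Here \<open>(-1)^(i - 1)\<close> is split so that the constants collect to
    \<open>(-1)^(card B - card A)\<close> and the rest to the power of the index sum, the two
    factors of \<open>incidence\<close>.\<close>
  also have "\<dots> = (\<Prod>i\<in>set js. (-1) * (-1) ^ i)"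
  proof (rule prod.cong[OF refl])
    fix i assume "i \<in> set js"
    then have "1 \<le> i" "i \<le> card B" using js(2) by auto
    then show "(-1) ^ card {y \<in> B. y < ?b i} = (-1) * (-1 :: int) ^ i"
      using card_less_nth_sorted_list_of_set[OF assms(1), of "i - 1"]
      by (cases i) auto
  qed
  also have "\<dots> = (-1) ^ card (set js) * (-1) ^ (\<Sum>i\<in>set js. i)"
    by (simp only: prod.distrib prod_constant power_sum)
  also have "card (set js) = card B - card A"
    using card_image[OF inj] im assms by (simp add: card_Diff_subset finite_subset)
  also have "(\<Sum>i\<in>set js. i) = sum_list js"
    using js(1) by (metis sum_list_distinct_conv_sum_set strict_sorted_iff list.map_ident)
  finally show ?thesis
    using False assms by (auto simp: incidence_def js_def)
qed

text \<open>The first factor on the right does not involve \<open>M\<close>. It is common to all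
  summands of an entry of the squared differential, so only \<open>inv_sign (M - A) (B - M)\<close>
  matters for their cancellation.\<close>

lemma incidence_mult:
  assumes "finite B" "A \<subseteq> M" "M \<subseteq> B"
  shows "incidence B M * incidence M A = inv_sign (B - A) B * inv_sign (M - A) (B - M)"
proof -
  have fin: "finite M" "finite (B - M)" "finite (M - A)"
    using assms by (auto intro: finite_subset)
  have "B - A = (B - M) \<union> (M - A)" using assms by blast
  then have "inv_sign (B - A) B = inv_sign (B - M) B * inv_sign (M - A) B"
    using fin assms by (subst inv_sign_Un_left[symmetric]) auto
  also have "inv_sign (M - A) B = inv_sign (M - A) (M \<union> (B - M))"
    using assms by (simp add: Un_absorb1)
  also have "\<dots> = inv_sign (M - A) M * inv_sign (M - A) (B - M)"
    using fin by (intro inv_sign_Un_right) auto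
  finally show ?thesis
    using assms fin by (simp add: incidence_eq_inv_sign mult.assoc)
qed

section \<open>Signs of orderings\<close>

text \<open>For a distinct list this is -1 to the number of inversions, that is, the sign of the
  permutation that sorts it. It is defined on lists because words have to be concatenated and
  cut.\<close>

fun list_sign :: "'n::linorder list \<Rightarrow> int" where
  "list_sign [] = 1"
| "list_sign (x # xs) = inv_sign {x} (set xs) * list_sign xs"

text \<open>An inversion lies inside \<open>xs\<close>, inside \<open>ys\<close>, or between the
  two. For fixed underlying sets the last kind gives the shuffle sign, which does not depend on the
  orderings.\<close>

lemma list_sign_append:
  assumes "distinct (xs @ ys)"
  shows "list_sign (xs @ ys) = list_sign xs * list_sign ys * inv_sign (set xs) (set ys)"
  using assms
proof (induction xs)
  case (Cons x xs)
  have "inv_sign {x} (set xs \<union> set ys) = inv_sign {x} (set xs) * inv_sign {x} (set ys)"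
    using Cons.prems by (intro inv_sign_Un_right) auto
  moreover have "inv_sign ({x} \<union> set xs) (set ys) = inv_sign {x} (set ys) * inv_sign (set xs) (set ys)"
    using Cons.prems by (intro inv_sign_Un_left) auto
  ultimately show ?case
    using Cons by simp
qed simp

lemma list_sign_swap_adjacent:
  assumes "distinct (xs @ a # b # ys)"
  shows "list_sign (xs @ b # a # ys) = - list_sign (xs @ a # b # ys)"
proof -
  have "list_sign (b # a # ys) = - list_sign (a # b # ys)"
    using assms by (auto simp: inv_sign_def)
  moreover have "distinct (xs @ b # a # ys)" using assms by auto
  ultimately show ?thesis
    using assms by (simp only: list_sign_append) (simp add: insert_commute)
qed

lemma list_sign_move:
  assumes "distinct (xs @ ys @ b # zs)"
  shows "list_sign (xs @ ys @ b # zs) = (-1) ^ length ys * list_sign (xs @ b # ys @ zs)"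
  using assms
proof (induction ys arbitrary: xs)
  case (Cons y ys)
  have "list_sign (xs @ (y # ys) @ b # zs) = list_sign ((xs @ [y]) @ ys @ b # zs)"
    by simp
  also have "\<dots> = (-1) ^ length ys * list_sign ((xs @ [y]) @ b # ys @ zs)"
    using Cons.prems by (intro Cons.IH) simp
  also have "list_sign ((xs @ [y]) @ b # ys @ zs) = list_sign (xs @ y # b # ys @ zs)"
    by simp
  also have "\<dots> = - list_sign (xs @ b # y # ys @ zs)"
    using Cons.prems by (intro list_sign_swap_adjacent) auto
  finally show ?case by simp
qed simp

text \<open>Move \<open>b\<close> left next to \<open>a\<close>, exchange the two neighbours, and
  move \<open>a\<close> right to the old place of \<open>b\<close>. Both moves cost
  \<open>(-1)^length ys\<close>, so only the sign of the exchange remains.\<close>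

lemma list_sign_swap:
  assumes "distinct (xs @ a # ys @ b # zs)"
  shows "list_sign (xs @ b # ys @ a # zs) = - list_sign (xs @ a # ys @ b # zs)"
proof -
  have "list_sign (xs @ a # ys @ b # zs) = (-1) ^ length ys * list_sign (xs @ a # b # ys @ zs)"
    using list_sign_move[of "xs @ [a]" ys b zs] assms by simp
  also have "list_sign (xs @ a # b # ys @ zs) = - list_sign (xs @ b # a # ys @ zs)"
    using assms by (intro list_sign_swap_adjacent) auto
  also have "(-1) ^ length ys * - list_sign (xs @ b # a # ys @ zs) = - list_sign (xs @ b # ys @ a # zs)"
    using list_sign_move[of "xs @ [b]" ys a zs] assms by auto
  finally show ?thesis by simp
qed

lemma list_sign_map_transpose:
  assumes "distinct xs" "a \<in> set xs" "b \<in> set xs" "a \<noteq> b"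
  shows "list_sign (map (transpose a b) xs) = - list_sign xs"
proof -
  have *: "list_sign (map (transpose a b) (ps @ a # qs @ b # rs)) = - list_sign (ps @ a # qs @ b # rs)"
    if "distinct (ps @ a # qs @ b # rs)" for a b :: 'a and ps qs rs
  proof -
    have "map (transpose a b) zs = zs" if "a \<notin> set zs" "b \<notin> set zs" for zs
      using that by (intro map_idI) (metis transpose_apply_other)
    then have "map (transpose a b) (ps @ a # qs @ b # rs) = ps @ b # qs @ a # rs"
      using that by simp
    then show ?thesis using list_sign_swap[OF that] by simp
  qed
  obtain ps ys where xs: "xs = ps @ a # ys" using assms(2) by (meson split_list)
  show ?thesis
  proof (cases "b \<in> set ys")
    case True
    then obtain qs rs where "ys = qs @ b # rs" by (meson split_list)
    then show ?thesis using * xs assms(1) by blast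
  next
    case False
    then have "b \<in> set ps" using xs assms by auto
    then obtain qs rs where "ps = qs @ b # rs" by (meson split_list)
    then have "xs = qs @ b # rs @ a # ys" using xs by simp
    then show ?thesis using *[of qs b rs a ys] assms(1) by (simp only: transpose_commute[of a b])
  qed
qed

lemma list_sign_sorted: "sorted_wrt (<) xs \<Longrightarrow> list_sign xs = 1"
proof (induction xs)
  case (Cons x xs)
  then have "inv_sign {x} (set xs) = 1"
    by (auto simp: inv_sign_def intro!: prod.neutral)
  with Cons show ?case by simp
qed simp

text \<open>Composing with a transposition on the left exchanges two values in the list, so both
  sides change sign along the induction that builds a permutation from transpositions.\<close>

lemma list_sign_map_permutes:
  assumes "\<sigma> permutes S" "finite S"
  shows "list_sign (map \<sigma> (sorted_list_of_set S)) = sign \<sigma>"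
  using assms
proof (induction rule: permutes_induct)
  case id
  then show ?case by (simp add: list_sign_sorted)
next
  case (swap a b p)
  let ?L = "sorted_list_of_set S"
  have "set (map p ?L) = S" "distinct (map p ?L)"
    using swap.hyps assms(2)
    by (auto simp: permutes_image distinct_map intro: permutes_inj_on)
  then have "list_sign (map (transpose a b) (map p ?L)) = - list_sign (map p ?L)"
    using swap.hyps by (intro list_sign_map_transpose) auto
  moreover have "sign (transpose a b \<circ> p) = - sign p"
    using swap.hyps assms(2)
    by (subst sign_compose)
      (auto simp: sign_swap_id permutation_swap_id intro: permutes_imp_permutation)
  ultimately show ?case using swap.IH by (simp only: map_map)
qed

lemma bij_betw_permutes_permutations_of_set:
  assumes "finite S"
  shows "bij_betw (\<lambda>\<sigma>. map \<sigma> (sorted_list_of_set S)) {\<sigma>. \<sigma> permutes S} (permutations_of_set S)"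
proof -
  let ?m = "\<lambda>\<sigma>. map \<sigma> (sorted_list_of_set S)"
  have inj: "inj_on ?m {\<sigma>. \<sigma> permutes S}"
  proof (rule inj_onI)
    fix \<sigma> \<tau> assume *: "\<sigma> \<in> {\<sigma>. \<sigma> permutes S}" "\<tau> \<in> {\<sigma>. \<sigma> permutes S}" "?m \<sigma> = ?m \<tau>"
    have "\<sigma> x = \<tau> x" for x
      using * assms by (cases "x \<in> S") (auto simp: permutes_not_in)
    then show "\<sigma> = \<tau>" by blast
  qed
  moreover have "?m ` {\<sigma>. \<sigma> permutes S} = permutations_of_set S"
  \<comment> \<open>Surjectivity is obtained by counting: both sets have
    \<open>fact (card S)\<close> elements.\<close>
  proof (rule card_subset_eq)
    show "?m ` {\<sigma>. \<sigma> permutes S} \<subseteq> permutations_of_set S"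
      using assms
      by (auto simp: permutations_of_set_def permutes_image distinct_map permutes_in_image
        intro: permutes_inj_on)
    show "card (?m ` {\<sigma>. \<sigma> permutes S}) = card (permutations_of_set S)"
      using assms by (simp add: card_image[OF inj] card_permutations)
  qed simp
  ultimately show ?thesis by (simp add: bij_betw_def)
qed

section \<open>Sums in abelian groups\<close>

lemma (in abelian_monoid) finsum_Sigma:
  assumes "finite I" "\<And>i. i \<in> I \<Longrightarrow> finite (J i)"
    and "\<And>i j. i \<in> I \<Longrightarrow> j \<in> J i \<Longrightarrow> f i j \<in> carrier G"
  shows "(\<Oplus>i\<in>I. \<Oplus>j\<in>J i. f i j) = (\<Oplus>p\<in>Sigma I J. f (fst p) (snd p))"
proof -
  let ?g = "\<lambda>p. f (fst p) (snd p)"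
  have "(\<Oplus>p\<in>(\<Union>i\<in>I. Pair i ` J i). ?g p) = (\<Oplus>i\<in>I. \<Oplus>p\<in>Pair i ` J i. ?g p)"
    using assms by (intro add.finprod_UN_disjoint) (auto simp: pairwise_def disjnt_def)
  also have "\<dots> = (\<Oplus>i\<in>I. \<Oplus>j\<in>J i. f i j)"
  proof (intro finsum_cong')
    fix i assume "i \<in> I"
    then show "(\<Oplus>p\<in>Pair i ` J i. ?g p) = (\<Oplus>j\<in>J i. f i j)"
      using assms(3) by (subst finsum_reindex) (auto simp: inj_on_def)
  qed (use assms(3) in \<open>auto intro!: finsum_closed\<close>)
  also have "(\<Union>i\<in>I. Pair i ` J i) = Sigma I J" by auto
  finally show ?thesis by simp
qed

lemma (in abelian_monoid) finsum_swap:
  assumes "finite I" "finite J" "\<And>i j. i \<in> I \<Longrightarrow> j \<in> J \<Longrightarrow> f i j \<in> carrier G"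
  shows "(\<Oplus>i\<in>I. \<Oplus>j\<in>J. f i j) = (\<Oplus>j\<in>J. \<Oplus>i\<in>I. f i j)"
  using assms(1,3)
proof (induction I)
  case (insert i I)
  have "(\<Oplus>i'\<in>insert i I. \<Oplus>j\<in>J. f i' j) = (\<Oplus>j\<in>J. f i j) \<oplus> (\<Oplus>i\<in>I. \<Oplus>j\<in>J. f i j)"
    using insert by (intro finsum_insert) (auto intro!: finsum_closed)
  also have "\<dots> = (\<Oplus>j\<in>J. f i j) \<oplus> (\<Oplus>j\<in>J. \<Oplus>i\<in>I. f i j)"
    using insert by simp
  also have "\<dots> = (\<Oplus>j\<in>J. f i j \<oplus> (\<Oplus>i\<in>I. f i j))"
    using insert.prems by (intro finsum_addf[symmetric]) (auto intro!: finsum_closed)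
  also have "\<dots> = (\<Oplus>j\<in>J. \<Oplus>i'\<in>insert i I. f i' j)"
    using insert by (intro finsum_cong' refl) (auto intro!: finsum_closed)
  finally show ?case .
qed simp

lemma (in abelian_group) add_pow_finsum:
  assumes "f \<in> A \<rightarrow> carrier G"
  shows "[(k :: int)] \<cdot> (\<Oplus>a\<in>A. f a) = (\<Oplus>a\<in>A. [k] \<cdot> f a)"
  using assms
proof (induction A rule: infinite_finite_induct)
  case (insert a A)
  have "[k] \<cdot> (f a \<oplus> finsum G f A) = [k] \<cdot> f a \<oplus> [k] \<cdot> finsum G f A"
    using insert.prems by (intro add.int_pow_distrib) auto
  then show ?case
    using insert by (simp add: Pi_def)
qed simp_all

lemma (in abelian_group) add_pow_uminus:
  assumes "x \<in> carrier G"
  shows "[(- k :: int)] \<cdot> x = \<ominus> ([k] \<cdot> x)"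
  using add.int_pow_neg[OF assms] .

lemma (in abelian_group) add_pow_add_pow:
  assumes "x \<in> carrier G"
  shows "[(k :: int)] \<cdot> ([(l :: int)] \<cdot> x) = [(k * l)] \<cdot> x"
  using add.int_pow_pow[OF assms, of k l] by (simp add: mult.commute)

lemma (in abelian_group_hom) hom_add_pow:
  assumes "x \<in> carrier G"
  shows "h ([(k :: int)] \<cdot> x) = [k] \<cdot>\<^bsub>H\<^esub> h x"
  using group_hom.hom_int_pow[OF a_group_hom, of x k] assms by (simp add: add_pow_def)

lemma (in abelian_group_hom) hom_finsum:
  assumes "f \<in> A \<rightarrow> carrier G"
  shows "h (\<Oplus>a\<in>A. f a) = (\<Oplus>\<^bsub>H\<^esub>a\<in>A. h (f a))"
  using assms
  by (induction A rule: infinite_finite_induct) (simp_all add: Pi_def)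

lemma (in abelian_group_hom) hom_minus:
  assumes "x \<in> carrier G" "y \<in> carrier G"
  shows "h (x \<ominus> y) = h x \<ominus>\<^bsub>H\<^esub> h y"
  using assms by (simp add: a_minus_def)

text \<open>Pairing the orderings of \<open>S\<close>, rather than changing variables, avoids a division by \<open>2\<close>.\<close>

lemma (in abelian_group) finsum_list_sign_eq_zero:
  fixes S :: "'n::linorder set"
  assumes S: "finite S" "Suc n < card S"
    and g: "\<And>xs. xs \<in> permutations_of_set S \<Longrightarrow> g xs \<in> carrier G"
    and swap: "\<And>us a b vs. length us = n \<Longrightarrow> us @ a # b # vs \<in> permutations_of_set S \<Longrightarrow>
      g (us @ a # b # vs) = g (us @ b # a # vs)"
  shows "(\<Oplus>xs\<in>permutations_of_set S. [list_sign xs] \<cdot> g xs) = \<zero>"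
proof -
  let ?P = "permutations_of_set S"
  \<comment> \<open>The order of the two letters at positions \<open>n\<close> and
    \<open>Suc n\<close> splits the orderings into two halves. The involution \<open>sw\<close>
    exchanges these letters, maps one half onto the other, keeps \<open>g\<close> and negates the
    sign.\<close>
  define P1 where "P1 = {xs \<in> ?P. xs ! n < xs ! Suc n}"
  define P2 where "P2 = {xs \<in> ?P. xs ! Suc n < xs ! n}"
  define sw where "sw xs = take n xs @ xs ! Suc n # xs ! n # drop (Suc (Suc n)) xs" for xs :: "'n list"
  let ?f = "\<lambda>xs. [list_sign xs] \<cdot> g xs"
  have split: "\<exists>us a b vs. xs = us @ a # b # vs \<and> length us = n" if "xs \<in> ?P" for xs
  proof -
    have "length xs = card S" using that S(1) by (simp add: length_finite_permutations_of_set)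
    then have "xs = take n xs @ xs ! n # xs ! Suc n # drop (Suc (Suc n)) xs"
      using S(2) by (simp add: Cons_nth_drop_Suc)
    then show ?thesis using S(2) \<open>length xs = card S\<close>
      by (metis Suc_lessD length_take less_imp_le min.absorb2)
  qed
  have sw: "sw (us @ a # b # vs) = us @ b # a # vs" if "length us = n" for us a b vs
    using that by (simp add: sw_def nth_append)
  have sw_P: "sw xs \<in> ?P \<and> sw (sw xs) = xs \<and> ?f (sw xs) = \<ominus> ?f xs \<and>
      sw xs ! n = xs ! Suc n \<and> sw xs ! Suc n = xs ! n \<and> xs ! n \<noteq> xs ! Suc n" if "xs \<in> ?P" for xs
  proof -
    obtain us a b vs where xs: "xs = us @ a # b # vs" "length us = n"
      using split[OF \<open>xs \<in> ?P\<close>] by blast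
    have d: "distinct (us @ a # b # vs)" and mem: "us @ b # a # vs \<in> ?P"
      using that xs(1) by (auto simp: permutations_of_set_def)
    have "?f (sw xs) = \<ominus> ?f xs"
      unfolding xs(1) sw[OF xs(2)] list_sign_swap_adjacent[OF d]
      using swap[OF xs(2), of a b vs] that xs g[OF mem] by (simp add: add_pow_uminus)
    then show ?thesis
      using xs d mem by (simp add: sw nth_append)
  qed
  have "P2 = sw ` P1"
  proof (intro equalityI subsetI)
    fix xs assume "xs \<in> P2"
    then have "sw xs \<in> P1" "xs = sw (sw xs)" using sw_P[of xs] by (auto simp: P1_def P2_def)
    then show "xs \<in> sw ` P1" by blast
  next
    fix xs assume "xs \<in> sw ` P1"
    then obtain ys where "ys \<in> P1" "xs = sw ys" by auto
    then show "xs \<in> P2" using sw_P[of ys] by (auto simp: P1_def P2_def)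
  qed
  moreover have "inj_on sw P1"
    using sw_P by (intro inj_on_inverseI[where g = sw]) (auto simp: P1_def)
  moreover have f: "?f xs \<in> carrier G" if "xs \<in> ?P" for xs
    using g[OF that] by simp
  ultimately have "finsum G ?f P2 = (\<Oplus>xs\<in>P1. ?f (sw xs))"
    using sw_P by (simp only:) (intro finsum_reindex, auto simp: P1_def)
  also have "\<dots> = (\<Oplus>xs\<in>P1. \<ominus> ?f xs)"
    using sw_P f by (intro finsum_cong' refl) (auto simp: P1_def)
  finally have P2: "finsum G ?f P2 = (\<Oplus>xs\<in>P1. \<ominus> ?f xs)" .
  have "?P = P1 \<union> P2" using sw_P by (auto simp: P1_def P2_def neq_iff)
  then have "finsum G ?f ?P = finsum G ?f (P1 \<union> P2)" by simp
  also have "\<dots> = finsum G ?f P1 \<oplus> finsum G ?f P2"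
    using f by (intro finsum_Un_disjoint) (auto simp: P1_def P2_def)
  also have "\<dots> = (\<Oplus>xs\<in>P1. ?f xs \<oplus> \<ominus> ?f xs)"
    unfolding P2 using f by (intro finsum_addf[symmetric]) (auto simp: P1_def)
  also have "\<dots> = \<zero>"
    using f by (intro add.finprod_one_eqI) (auto simp: P1_def r_neg)
  finally show ?thesis .
qed

section \<open>Module homomorphisms\<close>

lemma left_module_homD:
  assumes "f \<in> left_module_hom R M M'"
  shows "x \<in> carrier M \<Longrightarrow> f x \<in> carrier M'"
    and "x \<in> carrier M \<Longrightarrow> y \<in> carrier M \<Longrightarrow> f (x \<oplus>\<^bsub>M\<^esub> y) = f x \<oplus>\<^bsub>M'\<^esub> f y"
    and "r \<in> carrier R \<Longrightarrow> x \<in> carrier M \<Longrightarrow> f (r \<odot>\<^bsub>M\<^esub> x) = r \<odot>\<^bsub>M'\<^esub> f x"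
  using assms by (auto simp: left_module_hom_def)

text \<open>Homomorphisms are constrained on the carrier only. The structure maps of the cube are
  known only there, so their linearity has to be transported in this way.\<close>

lemma left_module_hom_cong:
  assumes "f \<in> left_module_hom R M M'" "left_module R M" "\<And>x. x \<in> carrier M \<Longrightarrow> g x = f x"
  shows "g \<in> left_module_hom R M M'"
proof -
  interpret left_module R M by fact
  show ?thesis using assms(1,3) by (simp add: left_module_hom_def Pi_iff)
qed

lemma left_module_hom_comp:
  assumes "f \<in> left_module_hom R M M'" "g \<in> left_module_hom R M' M''"
  shows "(\<lambda>x. g (f x)) \<in> left_module_hom R M M''"
  using assms by (simp add: left_module_hom_def Pi_iff)

lemma abelian_group_hom_additiveI:
  assumes "abelian_group M" "abelian_group M'"
    and "\<And>x. x \<in> carrier M \<Longrightarrow> f x \<in> carrier M'"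
    and "\<And>x y. x \<in> carrier M \<Longrightarrow> y \<in> carrier M \<Longrightarrow> f (x \<oplus>\<^bsub>M\<^esub> y) = f x \<oplus>\<^bsub>M'\<^esub> f y"
  shows "abelian_group_hom M M' f"
  using assms
  by (intro abelian_group_homI group_hom.intro group_hom_axioms.intro)
    (auto simp: hom_def abelian_group.a_group)

lemma left_module_abelian_group: "left_module R M \<Longrightarrow> abelian_group M"
  by (simp add: left_module_def)

lemma left_module_hom_abelian_group_hom:
  assumes "left_module R M" "left_module R M'" "f \<in> left_module_hom R M M'"
  shows "abelian_group_hom M M' f"
  using assms left_module_homD[OF assms(3)]
  by (intro abelian_group_hom_additiveI) (auto intro: left_module_abelian_group)

lemma left_module_hom_finsum:
  assumes "left_module R M" "left_module R M'"
    and f: "\<And>a. a \<in> A \<Longrightarrow> f a \<in> left_module_hom R M M'"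
  shows "(\<lambda>x. \<Oplus>\<^bsub>M'\<^esub>a\<in>A. [(c a :: int)] \<cdot>\<^bsub>M'\<^esub> f a x) \<in> left_module_hom R M M'"
proof -
  interpret M: left_module R M by fact
  interpret M': left_module R M' by fact
  note fD = left_module_homD[OF f]
  let ?F = "\<lambda>x. \<Oplus>\<^bsub>M'\<^esub>a\<in>A. [c a] \<cdot>\<^bsub>M'\<^esub> f a x"
  have closed: "?F x \<in> carrier M'" if "x \<in> carrier M" for x
    using fD that by (intro M'.finsum_closed) auto
  have add: "?F (x \<oplus>\<^bsub>M\<^esub> y) = ?F x \<oplus>\<^bsub>M'\<^esub> ?F y" if "x \<in> carrier M" "y \<in> carrier M" for x y
  proof -
    have "?F (x \<oplus>\<^bsub>M\<^esub> y) = (\<Oplus>\<^bsub>M'\<^esub>a\<in>A. [c a] \<cdot>\<^bsub>M'\<^esub> f a x \<oplus>\<^bsub>M'\<^esub> [c a] \<cdot>\<^bsub>M'\<^esub> f a y)"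
      using fD that by (intro M'.finsum_cong' refl) (auto simp: M'.add.int_pow_distrib)
    then show ?thesis
      using fD that by (subst M'.finsum_addf[symmetric]) auto
  qed
  have smult: "?F (r \<odot>\<^bsub>M\<^esub> x) = r \<odot>\<^bsub>M'\<^esub> ?F x" if "r \<in> carrier R" "x \<in> carrier M" for r x
  proof -
    \<comment> \<open>Scaling by \<open>r\<close> is additive, hence commutes with finite sums and
      with integer multiples. No integer has to be interpreted in \<open>R\<close>.\<close>
    interpret r: abelian_group_hom M' M' "\<lambda>y. r \<odot>\<^bsub>M'\<^esub> y"
      using that by (intro abelian_group_hom_additiveI)
        (auto simp: M'.smult_r_distr M'.abelian_group_axioms)
    have "r \<odot>\<^bsub>M'\<^esub> ?F x = (\<Oplus>\<^bsub>M'\<^esub>a\<in>A. r \<odot>\<^bsub>M'\<^esub> ([c a] \<cdot>\<^bsub>M'\<^esub> f a x))"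
      using fD that by (intro r.hom_finsum) auto
    also have "\<dots> = ?F (r \<odot>\<^bsub>M\<^esub> x)"
      using fD that by (intro M'.finsum_cong' refl) (auto simp: r.hom_add_pow)
    finally show ?thesis by simp
  qed
  show ?thesis using closed add smult by (auto simp: left_module_hom_def)
qed

text \<open>An ordering of \<open>S\<close> with an interior cut is the same as a proper nonempty
  subset \<open>T\<close>, the set of letters right of the cut, together with orderings of
  \<open>S - T\<close> and of \<open>T\<close>. Closure is demanded only for pairs of total length
  \<open>card S\<close>, since the degree of a composite depends on the lengths of its
  words.\<close>

lemma (in abelian_monoid) finsum_deconcatenation:
  assumes "finite S"
    and f: "\<And>us ts. set us \<union> set ts \<subseteq> S \<Longrightarrow> us \<noteq> [] \<Longrightarrow> ts \<noteq> [] \<Longrightarrow> length us + length ts = card S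
      \<Longrightarrow> f us ts \<in> carrier G"
  shows "(\<Oplus>xs\<in>permutations_of_set S. \<Oplus>j\<in>{1..<card S}. f (take j xs) (drop j xs)) =
    (\<Oplus>T\<in>Pow S - {{}, S}. \<Oplus>us\<in>permutations_of_set (S - T). \<Oplus>ts\<in>permutations_of_set T. f us ts)"
proof -
  let ?P = permutations_of_set
  define Q where "Q = Pow S - {{}, S}"
  let ?X = "Sigma (?P S) (\<lambda>_. {1..<card S})"
  let ?Y = "SIGMA T:Q. ?P (S - T) \<times> ?P T"
  \<comment> \<open>Concatenation remembers the cut as the length of the left part;
    \<open>\<psi>\<close> is its inverse.\<close>
  define \<phi> :: "'c set \<times> 'c list \<times> 'c list \<Rightarrow> 'c list \<times> nat" where
    "\<phi> = (\<lambda>(T, us, ts). (us @ ts, length us))"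
  define \<psi> :: "'c list \<times> nat \<Rightarrow> 'c set \<times> 'c list \<times> 'c list" where
    "\<psi> = (\<lambda>(xs, j). (set (drop j xs), take j xs, drop j xs))"
  have finQ: "finite Q" and finT: "\<And>T. T \<in> Q \<Longrightarrow> finite T"
    using assms(1) by (auto simp: Q_def intro: finite_subset)
  have len: "length xs = card S" if "xs \<in> ?P S" for xs
    using that assms(1) by (simp add: length_finite_permutations_of_set)
  have fX: "f (take j xs) (drop j xs) \<in> carrier G" if "xs \<in> ?P S" "j \<in> {1..<card S}" for xs j
  proof (rule f)
    show "set (take j xs) \<union> set (drop j xs) \<subseteq> S"
      using that(1) by (simp flip: set_append add: permutations_of_set_def)
  qed (use that len[OF that(1)] in auto)
  have fY: "f us ts \<in> carrier G" if "T \<in> Q" "us \<in> ?P (S - T)" "ts \<in> ?P T" for T us ts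
  proof (rule f)
    have [simp]: "finite T" using finT that by auto
    have "length us = card (S - T)" "length ts = card T"
      using that assms(1) by (auto simp: length_finite_permutations_of_set)
    moreover have "card S = card (S - T) + card T"
      using that assms(1) \<open>finite T\<close> by (auto simp: Q_def card_Diff_subset card_mono)
    ultimately show "length us + length ts = card S" by simp
  qed (use that in \<open>auto simp: Q_def permutations_of_set_def\<close>)
  have \<phi>: "\<phi> p \<in> ?X \<and> \<psi> (\<phi> p) = p" if "p \<in> ?Y" for p
  proof -
    obtain T us ts where p: "p = (T, us, ts)" by (cases p)
    have *: "T \<subseteq> S" "T \<noteq> {}" "T \<noteq> S" "set us = S - T" "distinct us" "set ts = T" "distinct ts"
      using that p by (auto simp: Q_def permutations_of_set_def)
    then have "us @ ts \<in> ?P S" "us \<noteq> []" "ts \<noteq> []"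
      by (auto simp: permutations_of_set_def)
    with len[of "us @ ts"] * show ?thesis
      by (cases us; cases ts) (auto simp: p Q_def \<phi>_def \<psi>_def)
  qed
  have \<psi>: "\<psi> q \<in> ?Y \<and> \<phi> (\<psi> q) = q" if "q \<in> ?X" for q
  proof -
    obtain xs j where q: "q = (xs, j)" by (cases q)
    have xs: "xs \<in> ?P S" "1 \<le> j" "j < card S" using that q by auto
    have "distinct (take j xs @ drop j xs)" "set (take j xs @ drop j xs) = S"
      using xs(1) by (simp_all only: append_take_drop_id permutations_of_setD)
    then have d: "distinct (take j xs)" "distinct (drop j xs)"
      "set (take j xs) \<inter> set (drop j xs) = {}" "set (take j xs) \<union> set (drop j xs) = S"
      by (simp_all only: distinct_append set_append)
    have ne: "take j xs \<noteq> []" "drop j xs \<noteq> []"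
      using xs len[OF xs(1)] by auto
    have "set (take j xs) = S - set (drop j xs)" using d by auto
    moreover have "set (drop j xs) \<subseteq> S" "set (drop j xs) \<noteq> {}" using d ne by auto
    moreover have "set (drop j xs) \<noteq> S" using d ne calculation(1) by auto
    ultimately show ?thesis
      using d(1,2) xs len[OF xs(1)] by (auto simp: q Q_def \<phi>_def \<psi>_def permutations_of_set_def)
  qed
  have "(\<Oplus>T\<in>Q. \<Oplus>us\<in>?P (S - T). \<Oplus>ts\<in>?P T. f us ts) =
      (\<Oplus>T\<in>Q. \<Oplus>p\<in>?P (S - T) \<times> ?P T. f (fst p) (snd p))"
    using fY by (intro finsum_cong' refl finsum_Sigma) (auto intro!: finsum_closed)
  also have "\<dots> = (\<Oplus>p\<in>?Y. f (fst (snd p)) (snd (snd p)))"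
    using finQ fY by (intro finsum_Sigma) auto
  also have "\<dots> = (\<Oplus>p\<in>?Y. f (take (snd (\<phi> p)) (fst (\<phi> p))) (drop (snd (\<phi> p)) (fst (\<phi> p))))"
    using fY by (intro finsum_cong' refl) (auto simp: \<phi>_def)
  also have "\<dots> = (\<Oplus>q\<in>\<phi> ` ?Y. f (take (snd q) (fst q)) (drop (snd q) (fst q)))"
  proof (rule finsum_reindex[symmetric])
    show "inj_on \<phi> ?Y" using \<phi> by (intro inj_on_inverseI[where g = \<psi>]) (simp only:)
    show "(\<lambda>q. f (take (snd q) (fst q)) (drop (snd q) (fst q))) \<in> \<phi> ` ?Y \<rightarrow> carrier G"
    proof (intro funcsetI)
      fix q assume "q \<in> \<phi> ` ?Y"
      then obtain p where "p \<in> ?Y" "q = \<phi> p" by (rule imageE)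
      then have "q \<in> ?X" using \<phi>[of p] by (simp only:)
      then show "f (take (snd q) (fst q)) (drop (snd q) (fst q)) \<in> carrier G"
        using fX by (cases q) auto
    qed
  qed
  also have "\<phi> ` ?Y = ?X"
  proof (intro equalityI subsetI)
    fix q assume "q \<in> ?X"
    then show "q \<in> \<phi> ` ?Y" using \<psi>[of q] by (intro image_eqI[of q \<phi> "\<psi> q"]) simp_all
  next
    fix q assume "q \<in> \<phi> ` ?Y"
    then obtain p where "p \<in> ?Y" "q = \<phi> p" by (rule imageE)
    then show "q \<in> ?X" using \<phi>[of p] by (simp only:)
  qed
  also have "(\<Oplus>q\<in>?X. f (take (snd q) (fst q)) (drop (snd q) (fst q))) =
      (\<Oplus>xs\<in>?P S. \<Oplus>j\<in>{1..<card S}. f (take j xs) (drop j xs))"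
    using fX by (intro finsum_Sigma[symmetric]) auto
  finally show ?thesis unfolding Q_def ..
qed

section \<open>Transfer along the homotopy\<close>

locale homotopy_transfer =
  fixes R :: "('r, 'z) ring_scheme"
    and N :: "'n::linorder set"
    and C :: "('r, 'c) graded_module" and dC :: "('c, 'c) graded_map"
    and D :: "('r, 'd) graded_module" and dD :: "('d, 'd) graded_map"
    and h :: "'n \<Rightarrow> ('d, 'd) graded_map"
    and \<alpha> :: "('c, 'd) graded_map" and \<beta> :: "('d, 'c) graded_map"
    and G :: "('d, 'd) graded_map"
  assumes finite_N: "finite N"
    and complex_D: "cochain_complex R D dD"
    and map_h: "\<And>k. k \<in> N \<Longrightarrow> cochain_map R D dD D dD (h k)"
    and h_commute: "\<And>k l i x. \<lbrakk>k \<in> N; l \<in> N; x \<in> carrier (D i)\<rbrakk> \<Longrightarrow>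
      h k i (h l i x) = h l i (h k i x)"
    and complex_C: "cochain_complex R C dC"
    and map_\<alpha>: "cochain_map R C dC D dD \<alpha>"
    and map_\<beta>: "cochain_map R D dD C dC \<beta>"
    and homotopy: "cochain_homotopy R D dD D dD (\<lambda>i x. x) (\<lambda>i x. \<alpha> i (\<beta> i x)) G"
begin

abbreviation W :: "'n list \<Rightarrow> ('d, 'd) graded_map" where
  "W \<equiv> hG_word h G"

lemma module_C: "left_module R (C i)" and module_D: "left_module R (D i)"
  using complex_C complex_D by (simp_all add: cochain_complex_def is_graded_module_def)

lemma group_C: "abelian_group (C i)" and group_D: "abelian_group (D i)"
  using module_C module_D by (blast intro: left_module_abelian_group)+

text \<open>The target degree is a variable bound by an equation, because degrees such as
  \<open>i - 1 + 1\<close> and \<open>i\<close> name the same module without being syntactically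
  equal.\<close>

lemma hom_dC: "j = i + 1 \<Longrightarrow> dC i \<in> left_module_hom R (C i) (C j)"
  and hom_dD: "j = i + 1 \<Longrightarrow> dD i \<in> left_module_hom R (D i) (D j)"
  and hom_h: "k \<in> N \<Longrightarrow> h k i \<in> left_module_hom R (D i) (D i)"
  and hom_G: "j = i - 1 \<Longrightarrow> G i \<in> left_module_hom R (D i) (D j)"
  and hom_\<alpha>: "\<alpha> i \<in> left_module_hom R (C i) (D i)"
  and hom_\<beta>: "\<beta> i \<in> left_module_hom R (D i) (C i)"
  using complex_C complex_D map_h homotopy map_\<alpha> map_\<beta>
  by (simp_all add: cochain_complex_def cochain_map_def cochain_homotopy_def graded_hom_def)

section \<open>Words in \<open>h\<close> and \<open>G\<close>\<close>

lemma W_Cons: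
  "ks \<noteq> [] \<Longrightarrow> W (k # ks) i x = h k (i - int (length ks)) (G (i + 1 - int (length ks)) (W ks i x))"
  by (cases ks) simp_all

text \<open>The recursion exposes the first letter only. At a cut the last letter of the left word
  is needed as well, as it meets the first letter of the right word.\<close>

lemma W_snoc: "us \<noteq> [] \<Longrightarrow> W (us @ [a]) i z = W us (i - 1) (G i (h a i z))"
proof (induction us)
  case (Cons u us)
  show ?case
  proof (cases "us = []")
    case False
    then show ?thesis using Cons.IH by (simp add: W_Cons algebra_simps)
  qed simp
qed simp

lemma hom_W:
  "xs \<noteq> [] \<Longrightarrow> set xs \<subseteq> N \<Longrightarrow> j = i + 1 - int (length xs) \<Longrightarrow> W xs i \<in> left_module_hom R (D i) (D j)"
proof (induction xs arbitrary: j)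
  case (Cons k ks)
  show ?case
  proof (cases "ks = []")
    case True
    have "W [k] i = h k i" by (simp add: fun_eq_iff)
    then show ?thesis using True Cons.prems hom_h by simp
  next
    case False
    have "i - int (length ks) = j" "i + 1 - int (length ks) = j + 1"
      using Cons.prems by simp_all
    then have "W (k # ks) i = (\<lambda>x. h k j (G (j + 1) (W ks i x)))"
      by (intro ext) (simp only: W_Cons[OF False])
    moreover have "(\<lambda>x. h k j (G (j + 1) (W ks i x))) \<in> left_module_hom R (D i) (D j)"
      using Cons.prems False
      by (intro left_module_hom_comp[OF _ hom_h] left_module_hom_comp[OF _ hom_G] Cons.IH) auto
    ultimately show ?thesis by simp
  qed
qed simp

lemmas closed_dD = left_module_homD(1)[OF hom_dD]
lemmas closed_h = left_module_homD(1)[OF hom_h]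
lemmas closed_G = left_module_homD(1)[OF hom_G]
lemmas closed_\<alpha> = left_module_homD(1)[OF hom_\<alpha>]
lemmas closed_\<beta> = left_module_homD(1)[OF hom_\<beta>]
lemmas closed_W = left_module_homD(1)[OF hom_W]

lemmas group_hom_dD = left_module_hom_abelian_group_hom[OF module_D module_D hom_dD]
lemmas group_hom_h = left_module_hom_abelian_group_hom[OF module_D module_D hom_h]
lemmas group_hom_\<beta> = left_module_hom_abelian_group_hom[OF module_D module_C hom_\<beta>]

lemma dC_dC: "x \<in> carrier (C i) \<Longrightarrow> dC (i + 1) (dC i x) = \<zero>\<^bsub>C (i + 2)\<^esub>"
  using complex_C by (simp add: cochain_complex_def)

lemma h_dD: "k \<in> N \<Longrightarrow> x \<in> carrier (D i) \<Longrightarrow> h k (i + 1) (dD i x) = dD i (h k i x)"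
  using map_h by (simp add: cochain_map_def)

lemma \<alpha>_dC: "x \<in> carrier (C i) \<Longrightarrow> \<alpha> (i + 1) (dC i x) = dD i (\<alpha> i x)"
  using map_\<alpha> by (simp add: cochain_map_def)

lemma \<beta>_dD: "x \<in> carrier (D i) \<Longrightarrow> \<beta> (i + 1) (dD i x) = dC i (\<beta> i x)"
  using map_\<beta> by (simp add: cochain_map_def)

text \<open>The error that arises when \<open>d\<close> passes \<open>G\<close>. The form
  \<open>d G + G d\<close> enters when \<open>d\<close> is moved through a word, the form here when
  the result is split into its two kinds of words.\<close>

definition \<delta> :: "('d, 'd) graded_map" where
  "\<delta> i x = \<alpha> i (\<beta> i x) \<ominus>\<^bsub>D i\<^esub> x"

lemma \<delta>_eq: "x \<in> carrier (D i) \<Longrightarrow> \<delta> i x = dD (i - 1) (G i x) \<oplus>\<^bsub>D i\<^esub> G (i + 1) (dD i x)"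
  using homotopy by (simp add: cochain_homotopy_def \<delta>_def)

lemma closed_\<delta>: "x \<in> carrier (D i) \<Longrightarrow> \<delta> i x \<in> carrier (D i)"
  unfolding \<delta>_def by (intro abelian_group.minus_closed group_D closed_\<alpha> closed_\<beta>)

text \<open>Push \<open>d\<close> from the right end of the word to the left end. It commutes with
  each \<open>h\<close>, and at each \<open>G\<close> the rule \<open>G d = \<delta> - d G\<close>
  leaves a term with \<open>\<delta>\<close> and changes the sign. The \<open>\<delta>\<close> at
  cut \<open>j\<close> appears after \<open>length xs - j - 1\<close> sign changes, and bringing it
  to the left side adds one more.\<close>

lemma W_leibniz:
  assumes "xs \<noteq> []" "set xs \<subseteq> N" "y \<in> carrier (D i)" "n = i + 2 - int (length xs)"
  shows "W xs (i + 1) (dD i y) \<oplus>\<^bsub>D n\<^esub> [((-1 :: int) ^ length xs)] \<cdot>\<^bsub>D n\<^esub> dD (n - 1) (W xs i y) \<oplus>\<^bsub>D n\<^esub>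
    (\<Oplus>\<^bsub>D n\<^esub>j\<in>{1..<length xs}. [((-1 :: int) ^ (length xs - j))] \<cdot>\<^bsub>D n\<^esub>
      W (take j xs) (n + int j - 1) (\<delta> (n + int j - 1) (W (drop j xs) i y))) = \<zero>\<^bsub>D n\<^esub>"
  using assms(1,2,4)
proof (induction xs arbitrary: n)
  case (Cons k ks)
  interpret Dn: abelian_group "D n" by (rule group_D)
  have k: "k \<in> N" and ks: "set ks \<subseteq> N" using Cons.prems by auto
  show ?case
  proof (cases "ks = []")
    case True
    then have n: "n = i + 1" using Cons.prems by simp
    have "dD i (h k i y) \<in> carrier (D n)"
      using k assms(3) n by (intro closed_dD closed_h) auto
    moreover have "[(- 1 :: int)] \<cdot>\<^bsub>D n\<^esub> dD i (h k i y) = \<ominus>\<^bsub>D n\<^esub> dD i (h k i y)"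
      using calculation Dn.add_pow_uminus[of _ 1] by simp
    moreover have "W [k] (i + 1) (dD i y) = dD i (h k i y)" "dD (n - 1) (W [k] i y) = dD i (h k i y)"
      using n h_dD[OF k assms(3)] by simp_all
    ultimately show ?thesis
      using True by (simp add: Dn.r_neg)
  next
    case False
    interpret D1: abelian_group "D (n + 1)" by (rule group_D)
    interpret hk: abelian_group_hom "D n" "D n" "h k n" by (rule group_hom_h[OF k])
    \<comment> \<open>The induction hypothesis for \<open>ks\<close> is an equation in degree
      \<open>n + 1\<close>; prefixing \<open>h k\<close> and \<open>G\<close> turns it into one in
      degree \<open>n\<close>.\<close>
    interpret \<phi>: abelian_group_hom "D (n + 1)" "D n" "\<lambda>z. h k n (G (n + 1) z)"
      by (rule left_module_hom_abelian_group_hom[OF module_D module_D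
        left_module_hom_comp[OF hom_G hom_h[OF k]]]) simp
    let ?s = "length ks"
    let ?c = "(-1 :: int) ^ ?s"
    define w where "w = W ks i y"
    define X where "X = W ks (i + 1) (dD i y)"
    define e where "e j = W (take j ks) (n + int j) (\<delta> (n + int j) (W (drop j ks) i y))" for j
    have n: "n = i + 1 - int ?s" using Cons.prems by simp
    have deg: "n + 1 - 1 = n" "n + 1 + int j - 1 = n + int j" "n + 1 = i + 2 - int ?s" for j
      using n by simp_all
    have w: "w \<in> carrier (D n)"
      unfolding w_def using False ks assms(3) n by (intro closed_W) auto
    have X: "X \<in> carrier (D (n + 1))"
      unfolding X_def using False ks assms(3) n by (intro closed_W closed_dD) auto
    have dw: "dD n w \<in> carrier (D (n + 1))" by (rule closed_dD[OF _ w]) simp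
    have Gw: "G n w \<in> carrier (D (n - 1))" by (rule closed_G[OF _ w]) simp
    have dGw: "dD (n - 1) (G n w) \<in> carrier (D n)" by (rule closed_dD[OF _ Gw]) simp
    have Gdw: "G (n + 1) (dD n w) \<in> carrier (D n)" by (rule closed_G[OF _ dw]) simp
    have e: "e j \<in> carrier (D (n + 1))" if "j \<in> {1..<?s}" for j
      unfolding e_def using that ks assms(3) n
      by (intro closed_W closed_\<delta>) (auto dest: in_set_takeD in_set_dropD)
    let ?Z = "\<Oplus>\<^bsub>D n\<^esub>j\<in>{1..<?s}. [((-1 :: int) ^ (?s - j))] \<cdot>\<^bsub>D n\<^esub> h k n (G (n + 1) (e j))"
    have Z: "?Z \<in> carrier (D n)" using e by (intro Dn.finsum_closed) auto
    define Y where "Y = (\<Oplus>\<^bsub>D (n + 1)\<^esub>j\<in>{1..<?s}. [((-1 :: int) ^ (?s - j))] \<cdot>\<^bsub>D (n + 1)\<^esub> e j)"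
    have Y: "Y \<in> carrier (D (n + 1))"
      unfolding Y_def using e by (intro D1.finsum_closed) auto
    have \<phi>Y: "h k n (G (n + 1) Y) = ?Z"
    proof -
      have "h k n (G (n + 1) Y) =
          (\<Oplus>\<^bsub>D n\<^esub>j\<in>{1..<?s}. h k n (G (n + 1) ([((-1 :: int) ^ (?s - j))] \<cdot>\<^bsub>D (n + 1)\<^esub> e j)))"
        unfolding Y_def using e by (intro \<phi>.hom_finsum) auto
      also have "\<dots> = ?Z"
        using e by (intro Dn.finsum_cong' refl) (auto simp: \<phi>.hom_add_pow)
      finally show ?thesis .
    qed
    have "X \<oplus>\<^bsub>D (n + 1)\<^esub> [?c] \<cdot>\<^bsub>D (n + 1)\<^esub> dD n w \<oplus>\<^bsub>D (n + 1)\<^esub> Y = \<zero>\<^bsub>D (n + 1)\<^esub>"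
      using Cons.IH[OF False ks deg(3)] by (simp only: deg(1,2) X_def w_def e_def Y_def)
    from arg_cong[OF this, of "\<lambda>z. h k n (G (n + 1) z)"]
    have "h k n (G (n + 1) X) \<oplus>\<^bsub>D n\<^esub> [?c] \<cdot>\<^bsub>D n\<^esub> h k n (G (n + 1) (dD n w)) \<oplus>\<^bsub>D n\<^esub>
        h k n (G (n + 1) Y) = \<zero>\<^bsub>D n\<^esub>"
      using X dw Y by (simp add: \<phi>.hom_add_pow)
    then have IH: "h k n (G (n + 1) X) \<oplus>\<^bsub>D n\<^esub> [?c] \<cdot>\<^bsub>D n\<^esub> h k n (G (n + 1) (dD n w)) \<oplus>\<^bsub>D n\<^esub> ?Z = \<zero>\<^bsub>D n\<^esub>"
      by (simp only: \<phi>Y)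
    have W1: "W (k # ks) (i + 1) (dD i y) = h k n (G (n + 1) X)"
    proof -
      have "i + 1 - int ?s = n" "i + 1 + 1 - int ?s = n + 1" using n by simp_all
      then show ?thesis by (simp only: W_Cons[OF False] X_def)
    qed
    have "W (k # ks) i y = h k (n - 1) (G n w)"
    proof -
      have "i - int ?s = n - 1" "i + 1 - int ?s = n" using n by simp_all
      then show ?thesis by (simp only: W_Cons[OF False] w_def)
    qed
    then have W2: "dD (n - 1) (W (k # ks) i y) = h k n (dD (n - 1) (G n w))"
      using h_dD[OF k Gw] by simp
    \<comment> \<open>The cuts of \<open>k # ks\<close> are the new one right after \<open>k\<close>
      and the cuts of \<open>ks\<close> shifted by one.\<close>
    have "{1..<length (k # ks)} = insert 1 (Suc ` {1..<?s})"
      using False by (cases ks) auto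
    then have "(\<Oplus>\<^bsub>D n\<^esub>j\<in>{1..<length (k # ks)}. [((-1 :: int) ^ (length (k # ks) - j))] \<cdot>\<^bsub>D n\<^esub>
        W (take j (k # ks)) (n + int j - 1) (\<delta> (n + int j - 1) (W (drop j (k # ks)) i y))) =
      (\<Oplus>\<^bsub>D n\<^esub>j\<in>insert 1 (Suc ` {1..<?s}). [((-1 :: int) ^ (length (k # ks) - j))] \<cdot>\<^bsub>D n\<^esub>
        W (take j (k # ks)) (n + int j - 1) (\<delta> (n + int j - 1) (W (drop j (k # ks)) i y)))"
      by (simp only:)
    also have "\<dots> = [?c] \<cdot>\<^bsub>D n\<^esub> h k n (\<delta> n w) \<oplus>\<^bsub>D n\<^esub> ?Z"
    proof -
      let ?f = "\<lambda>j. [((-1 :: int) ^ (length (k # ks) - j))] \<cdot>\<^bsub>D n\<^esub>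
        W (take j (k # ks)) (n + int j - 1) (\<delta> (n + int j - 1) (W (drop j (k # ks)) i y))"
      have f1: "?f 1 = [?c] \<cdot>\<^bsub>D n\<^esub> h k n (\<delta> n w)" by (simp add: w_def)
      have fS: "?f (Suc j) = [((-1 :: int) ^ (?s - j))] \<cdot>\<^bsub>D n\<^esub> h k n (G (n + 1) (e j))"
        if "j \<in> {1..<?s}" for j
      proof -
        have "take j ks \<noteq> []" "length (take j ks) = j" using that by auto
        then show ?thesis by (simp add: W_Cons e_def algebra_simps)
      qed
      have "?f 1 \<in> carrier (D n)"
        unfolding f1 using w k by (intro Dn.add.int_pow_closed closed_h closed_\<delta>)
      moreover have "?f \<in> Suc ` {1..<?s} \<rightarrow> carrier (D n)"
      proof (intro funcsetI, elim imageE)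
        fix j x assume "x = Suc j" "j \<in> {1..<?s}"
        then show "?f x \<in> carrier (D n)" using fS[of j] e[of j] by (simp only:) simp
      qed
      ultimately have "finsum (D n) ?f (insert 1 (Suc ` {1..<?s})) =
          ?f 1 \<oplus>\<^bsub>D n\<^esub> finsum (D n) ?f (Suc ` {1..<?s})"
        by (intro Dn.finsum_insert) auto
      also have "finsum (D n) ?f (Suc ` {1..<?s}) = (\<Oplus>\<^bsub>D n\<^esub>j\<in>{1..<?s}. ?f (Suc j))"
        using \<open>?f \<in> _\<close> by (intro Dn.finsum_reindex) auto
      also have "\<dots> = ?Z"
        using fS e by (intro Dn.finsum_cong' refl) auto
      finally show ?thesis by (simp only: f1)
    qed
    also have "h k n (\<delta> n w) = h k n (dD (n - 1) (G n w)) \<oplus>\<^bsub>D n\<^esub> h k n (G (n + 1) (dD n w))"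
      using w dGw Gdw by (simp add: \<delta>_eq)
    also have "[?c] \<cdot>\<^bsub>D n\<^esub> \<dots> = [?c] \<cdot>\<^bsub>D n\<^esub> h k n (dD (n - 1) (G n w)) \<oplus>\<^bsub>D n\<^esub>
        [?c] \<cdot>\<^bsub>D n\<^esub> h k n (G (n + 1) (dD n w))"
      using dGw Gdw by (simp add: Dn.add.int_pow_distrib)
    finally have sum: "(\<Oplus>\<^bsub>D n\<^esub>j\<in>{1..<length (k # ks)}. [((-1 :: int) ^ (length (k # ks) - j))] \<cdot>\<^bsub>D n\<^esub>
        W (take j (k # ks)) (n + int j - 1) (\<delta> (n + int j - 1) (W (drop j (k # ks)) i y))) = \<dots> \<oplus>\<^bsub>D n\<^esub> ?Z" .
    have "(-1 :: int) ^ length (k # ks) = - ?c" by simp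
    then have neg: "[((-1 :: int) ^ length (k # ks))] \<cdot>\<^bsub>D n\<^esub> h k n (dD (n - 1) (G n w)) =
        \<ominus>\<^bsub>D n\<^esub> ([?c] \<cdot>\<^bsub>D n\<^esub> h k n (dD (n - 1) (G n w)))"
      using dGw by (simp only: Dn.add_pow_uminus hk.hom_closed)
    \<comment> \<open>The term \<open>P\<close> is a signed \<open>h k d G w\<close>. It occurs once
      because \<open>d\<close> leaves the word on the left and once, with the opposite sign, in the
      \<open>\<delta>\<close> of the new cut; \<open>Q\<close> is the remaining half of that
      \<open>\<delta>\<close>.\<close>
    have cancel: "a \<oplus>\<^bsub>D n\<^esub> \<ominus>\<^bsub>D n\<^esub> P \<oplus>\<^bsub>D n\<^esub> (P \<oplus>\<^bsub>D n\<^esub> Q \<oplus>\<^bsub>D n\<^esub> Z) = a \<oplus>\<^bsub>D n\<^esub> Q \<oplus>\<^bsub>D n\<^esub> Z"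
      if "a \<in> carrier (D n)" "P \<in> carrier (D n)" "Q \<in> carrier (D n)" "Z \<in> carrier (D n)" for a P Q Z
    proof -
      have "\<ominus>\<^bsub>D n\<^esub> P \<oplus>\<^bsub>D n\<^esub> (P \<oplus>\<^bsub>D n\<^esub> (Q \<oplus>\<^bsub>D n\<^esub> Z)) = Q \<oplus>\<^bsub>D n\<^esub> Z"
        using that by (simp add: Dn.a_assoc[symmetric] Dn.l_neg)
      then show ?thesis using that by (simp add: Dn.a_assoc)
    qed
    show ?thesis
      unfolding W1 W2 sum neg using IH X dGw Gdw dw Z by (subst cancel) auto
  qed
qed simp

text \<open>These are the words in which the \<open>G\<close> at cut \<open>j\<close> has been
  replaced by the identity. The letters on both sides of the cut then act in direct succession, so
  exchanging them fixes the composite and flips the sign.\<close>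

lemma finsum_W_take_drop_eq_zero:
  assumes S: "S \<subseteq> N" and j: "1 \<le> j" "j < card S" and y: "y \<in> carrier (D i)"
    and n: "n = i + 2 - int (card S)"
  shows "(\<Oplus>\<^bsub>D n\<^esub>xs\<in>permutations_of_set S. [list_sign xs] \<cdot>\<^bsub>D n\<^esub>
    W (take j xs) (n + int j - 1) (W (drop j xs) i y)) = \<zero>\<^bsub>D n\<^esub>"
\<comment> \<open>With positions counted from 0, the letters next to cut \<open>j\<close> stand at
  \<open>j - 1\<close> and \<open>j\<close>.\<close>
proof (rule abelian_group.finsum_list_sign_eq_zero[OF group_D, where n = "j - 1"])
  let ?m = "n + int j - 1"
  show fin: "finite S" using S finite_N by (rule finite_subset)
  show "Suc (j - 1) < card S" using j by simp
  fix xs assume xs: "xs \<in> permutations_of_set S"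
  then have "length xs = card S" using fin by (simp add: length_finite_permutations_of_set)
  moreover have "set xs \<subseteq> N" using xs S by (simp add: permutations_of_setD)
  ultimately show "W (take j xs) ?m (W (drop j xs) i y) \<in> carrier (D n)"
    using j y n by (intro closed_W) (auto dest: in_set_takeD in_set_dropD)
next
  let ?m = "n + int j - 1"
  fix us a b vs assume us: "length us = j - 1" and xs: "us @ a # b # vs \<in> permutations_of_set S"
  have "finite S" using S finite_N by (rule finite_subset)
  then have "length (us @ a # b # vs) = card S"
    using xs by (intro length_finite_permutations_of_set) auto
  then have m: "?m = i - int (length vs)" using us j n by simp
  have N: "a \<in> N" "b \<in> N" "set vs \<subseteq> N" using xs S by (auto simp: permutations_of_set_def)
  have take_drop: "take j (us @ a # b # vs) = us @ [a]" "drop j (us @ a # b # vs) = b # vs" for a b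
    using us j by (simp_all add: take_Cons' drop_Cons')
  \<comment> \<open>The element on which the first letter of the right word acts: \<open>y\<close>
    itself if that letter is the whole right word.\<close>
  define t where "t = (if vs = [] then y else G (?m + 1) (W vs i y))"
  have t: "t \<in> carrier (D ?m)"
    using y N m by (auto simp: t_def intro!: closed_G closed_W)
  have right: "W (b # vs) i y = h b ?m t" for b
  proof (cases "vs = []")
    case False
    have "i + 1 - int (length vs) = ?m + 1" using m by simp
    then show ?thesis
      using False by (simp only: W_Cons[OF False] t_def m if_False)
  qed (use m in \<open>simp add: t_def\<close>)
  have left: "W (us @ [a]) ?m z = (if us = [] then h a ?m z else W us (?m - 1) (G ?m (h a ?m z)))" for a z
    by (simp add: W_snoc)
  show "W (take j (us @ a # b # vs)) ?m (W (drop j (us @ a # b # vs)) i y) =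
      W (take j (us @ b # a # vs)) ?m (W (drop j (us @ b # a # vs)) i y)"
    unfolding take_drop left right using h_commute[OF N(1,2) t] by simp
qed

section \<open>Antisymmetrised words\<close>

definition antisym :: "'n set \<Rightarrow> ('d, 'd) graded_map" where
  "antisym S i y = (\<Oplus>\<^bsub>D (i + 1 - int (card S))\<^esub>xs\<in>permutations_of_set S.
     [list_sign xs] \<cdot>\<^bsub>D (i + 1 - int (card S))\<^esub> W xs i y)"

lemma hom_W_permutations:
  assumes "S \<subseteq> N" "S \<noteq> {}" "xs \<in> permutations_of_set S" "j = i + 1 - int (card S)"
  shows "W xs i \<in> left_module_hom R (D i) (D j)"
  using assms finite_subset[OF assms(1) finite_N]
  by (intro hom_W) (auto simp: length_finite_permutations_of_set dest: permutations_of_setD)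

lemma hom_antisym:
  assumes "S \<subseteq> N" "S \<noteq> {}" "j = i + 1 - int (card S)"
  shows "antisym S i \<in> left_module_hom R (D i) (D j)"
proof -
  have "(\<lambda>x. \<Oplus>\<^bsub>D j\<^esub>xs\<in>permutations_of_set S. [list_sign xs] \<cdot>\<^bsub>D j\<^esub> W xs i x)
      \<in> left_module_hom R (D i) (D j)"
    using hom_W_permutations[OF assms(1,2) _ assms(3)]
    by (intro left_module_hom_finsum module_D)
  then show ?thesis unfolding antisym_def[abs_def] assms(3) .
qed

lemmas closed_antisym = left_module_homD(1)[OF hom_antisym]

text \<open>After expanding both antisymmetrisations, the two list signs and the shuffle sign
  \<open>inv_sign U T\<close> combine to the sign of the concatenation. The coefficient then depends
  on the two words alone, as needed to recognise a sum over cut orderings of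
  \<open>U \<union> T\<close>.\<close>

lemma antisym_\<alpha>\<beta>_antisym:
  assumes T: "T \<subseteq> N" "T \<noteq> {}" and U: "U \<subseteq> N" "U \<noteq> {}" and disj: "U \<inter> T = {}"
    and y: "y \<in> carrier (D i)"
    and m: "m = i + 1 - int (card T)" and n: "n = m + 1 - int (card U)"
  shows "[((-1 :: int) ^ card T * inv_sign U T)] \<cdot>\<^bsub>D n\<^esub> antisym U m (\<alpha> m (\<beta> m (antisym T i y))) =
    (\<Oplus>\<^bsub>D n\<^esub>us\<in>permutations_of_set U. \<Oplus>\<^bsub>D n\<^esub>ts\<in>permutations_of_set T.
      [(list_sign (us @ ts) * (-1) ^ length ts)] \<cdot>\<^bsub>D n\<^esub> W us m (\<alpha> m (\<beta> m (W ts i y))))"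
proof -
  interpret Dn: abelian_group "D n" by (rule group_D)
  interpret Dm: abelian_group "D m" by (rule group_D)
  have fin: "finite T" "finite U" using T U finite_N by (auto intro: finite_subset)
  let ?PU = "permutations_of_set U" and ?PT = "permutations_of_set T"
  let ?c = "(-1 :: int) ^ card T * inv_sign U T"
  have hom: "(\<lambda>z. W us m (\<alpha> m (\<beta> m z))) \<in> left_module_hom R (D m) (D n)" if "us \<in> ?PU" for us
    by (rule left_module_hom_comp[OF left_module_hom_comp[OF hom_\<beta> hom_\<alpha>] hom_W_permutations[OF U that n]])
  have WT: "W ts i y \<in> carrier (D m)" if "ts \<in> ?PT" for ts
    using left_module_homD(1)[OF hom_W_permutations[OF T that m] y] .
  have closed: "W us m (\<alpha> m (\<beta> m (W ts i y))) \<in> carrier (D n)" if "us \<in> ?PU" "ts \<in> ?PT" for us ts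
    using left_module_homD(1)[OF hom[OF that(1)] WT[OF that(2)]] .
  have inner: "W us m (\<alpha> m (\<beta> m (antisym T i y))) =
      (\<Oplus>\<^bsub>D n\<^esub>ts\<in>?PT. [list_sign ts] \<cdot>\<^bsub>D n\<^esub> W us m (\<alpha> m (\<beta> m (W ts i y))))" if us: "us \<in> ?PU" for us
  proof -
    interpret w: abelian_group_hom "D m" "D n" "\<lambda>z. W us m (\<alpha> m (\<beta> m z))"
      by (rule left_module_hom_abelian_group_hom[OF module_D module_D hom[OF us]])
    have "W us m (\<alpha> m (\<beta> m (antisym T i y))) =
        (\<Oplus>\<^bsub>D n\<^esub>ts\<in>?PT. W us m (\<alpha> m (\<beta> m ([list_sign ts] \<cdot>\<^bsub>D m\<^esub> W ts i y))))"
      unfolding antisym_def m[symmetric] using WT by (intro w.hom_finsum) auto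
    also have "\<dots> = (\<Oplus>\<^bsub>D n\<^esub>ts\<in>?PT. [list_sign ts] \<cdot>\<^bsub>D n\<^esub> W us m (\<alpha> m (\<beta> m (W ts i y))))"
      using WT us closed by (intro Dn.finsum_cong' refl) (auto simp: w.hom_add_pow)
    finally show ?thesis .
  qed
  have "[?c] \<cdot>\<^bsub>D n\<^esub> antisym U m (\<alpha> m (\<beta> m (antisym T i y))) =
      [?c] \<cdot>\<^bsub>D n\<^esub> (\<Oplus>\<^bsub>D n\<^esub>us\<in>?PU. [list_sign us] \<cdot>\<^bsub>D n\<^esub>
        (\<Oplus>\<^bsub>D n\<^esub>ts\<in>?PT. [list_sign ts] \<cdot>\<^bsub>D n\<^esub> W us m (\<alpha> m (\<beta> m (W ts i y)))))"
    unfolding antisym_def[of U] n[symmetric]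
    using closed inner by (intro arg_cong[where f = "\<lambda>z. [?c] \<cdot>\<^bsub>D n\<^esub> z"] Dn.finsum_cong' refl)
      (auto intro!: Dn.finsum_closed)
  also have "\<dots> = (\<Oplus>\<^bsub>D n\<^esub>us\<in>?PU. [?c] \<cdot>\<^bsub>D n\<^esub> ([list_sign us] \<cdot>\<^bsub>D n\<^esub>
        (\<Oplus>\<^bsub>D n\<^esub>ts\<in>?PT. [list_sign ts] \<cdot>\<^bsub>D n\<^esub> W us m (\<alpha> m (\<beta> m (W ts i y))))))"
    using closed by (intro Dn.add_pow_finsum) (auto intro!: Dn.finsum_closed)
  also have "\<dots> = (\<Oplus>\<^bsub>D n\<^esub>us\<in>?PU. \<Oplus>\<^bsub>D n\<^esub>ts\<in>?PT.
      [(list_sign (us @ ts) * (-1) ^ length ts)] \<cdot>\<^bsub>D n\<^esub> W us m (\<alpha> m (\<beta> m (W ts i y))))"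
  proof (intro Dn.finsum_cong' refl)
    fix us assume us: "us \<in> ?PU"
    have "[?c] \<cdot>\<^bsub>D n\<^esub> ([list_sign us] \<cdot>\<^bsub>D n\<^esub>
        (\<Oplus>\<^bsub>D n\<^esub>ts\<in>?PT. [list_sign ts] \<cdot>\<^bsub>D n\<^esub> W us m (\<alpha> m (\<beta> m (W ts i y))))) =
        [(?c * list_sign us)] \<cdot>\<^bsub>D n\<^esub>
        (\<Oplus>\<^bsub>D n\<^esub>ts\<in>?PT. [list_sign ts] \<cdot>\<^bsub>D n\<^esub> W us m (\<alpha> m (\<beta> m (W ts i y))))"
      using closed us by (intro Dn.add_pow_add_pow Dn.finsum_closed) auto
    also have "\<dots> = (\<Oplus>\<^bsub>D n\<^esub>ts\<in>?PT. [(?c * list_sign us)] \<cdot>\<^bsub>D n\<^esub>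
        ([list_sign ts] \<cdot>\<^bsub>D n\<^esub> W us m (\<alpha> m (\<beta> m (W ts i y)))))"
      using closed us by (intro Dn.add_pow_finsum) auto
    also have "\<dots> = (\<Oplus>\<^bsub>D n\<^esub>ts\<in>?PT.
        [(list_sign (us @ ts) * (-1) ^ length ts)] \<cdot>\<^bsub>D n\<^esub> W us m (\<alpha> m (\<beta> m (W ts i y))))"
    proof (intro Dn.finsum_cong' refl)
      fix ts assume ts: "ts \<in> ?PT"
      have "distinct (us @ ts)" using us ts disj by (auto simp: permutations_of_set_def)
      then have "list_sign (us @ ts) = list_sign us * list_sign ts * inv_sign U T"
        using us ts by (simp add: list_sign_append permutations_of_setD)
      moreover have "length ts = card T" using ts fin by (simp add: length_finite_permutations_of_set)
      ultimately have "?c * list_sign us * list_sign ts = list_sign (us @ ts) * (-1) ^ length ts"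
        by simp
      then show "[(?c * list_sign us)] \<cdot>\<^bsub>D n\<^esub> ([list_sign ts] \<cdot>\<^bsub>D n\<^esub> W us m (\<alpha> m (\<beta> m (W ts i y)))) =
          [(list_sign (us @ ts) * (-1) ^ length ts)] \<cdot>\<^bsub>D n\<^esub> W us m (\<alpha> m (\<beta> m (W ts i y)))"
        using closed[OF us ts] by (simp only: Dn.add_pow_add_pow)
    qed (use closed us in auto)
    finally show "[?c] \<cdot>\<^bsub>D n\<^esub> ([list_sign us] \<cdot>\<^bsub>D n\<^esub>
        (\<Oplus>\<^bsub>D n\<^esub>ts\<in>?PT. [list_sign ts] \<cdot>\<^bsub>D n\<^esub> W us m (\<alpha> m (\<beta> m (W ts i y))))) = \<dots>" .
  qed (use closed in \<open>auto intro!: Dn.finsum_closed\<close>)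
  finally show ?thesis .
qed

text \<open>The signed sum of \<open>W_leibniz\<close> over all orderings. This is the required
  relation before it is composed with \<open>\<alpha>\<close> on the right and
  \<open>\<beta>\<close> on the left; \<open>(-1)^card T\<close> is the sign with which
  \<open>d\<close> reaches the cut that has \<open>card T\<close> letters on its right.\<close>

lemma antisym_leibniz:
  assumes S: "S \<subseteq> N" "S \<noteq> {}" and y: "y \<in> carrier (D i)" and n: "n = i + 2 - int (card S)"
  shows "antisym S (i + 1) (dD i y) \<oplus>\<^bsub>D n\<^esub>
    [((-1 :: int) ^ card S)] \<cdot>\<^bsub>D n\<^esub> dD (n - 1) (antisym S i y) \<oplus>\<^bsub>D n\<^esub>
    (\<Oplus>\<^bsub>D n\<^esub>T\<in>Pow S - {{}, S}. [((-1 :: int) ^ card T * inv_sign (S - T) T)] \<cdot>\<^bsub>D n\<^esub>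
      antisym (S - T) (i + 1 - int (card T))
        (\<alpha> (i + 1 - int (card T)) (\<beta> (i + 1 - int (card T)) (antisym T i y)))) = \<zero>\<^bsub>D n\<^esub>"
proof -
  interpret Dn: abelian_group "D n" by (rule group_D)
  let ?P = "permutations_of_set S" and ?J = "{1..<card S}"
  have fin: "finite S" using S finite_N by (auto intro: finite_subset)
  \<comment> \<open>The degree at the cut is read off from the length of the left word, so that
    \<open>\<Psi>\<close> and \<open>f\<close> are functions of two words without reference to a cut
    position.\<close>
  define m where "m us = n + int (length us) - 1" for us :: "'n list"
  define \<Psi> where "\<Psi> us ts = W us (m us) (\<alpha> (m us) (\<beta> (m us) (W ts i y)))" for us ts
  define V where "V j xs = W (take j xs) (n + int j - 1) (W (drop j xs) i y)" for j xs
  define f where "f us ts = [(list_sign (us @ ts) * (-1 :: int) ^ length ts)] \<cdot>\<^bsub>D n\<^esub> \<Psi> us ts" for us ts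
  define c where "c j = (-1 :: int) ^ (card S - j)" for j
  define L where "L xs = W xs (i + 1) (dD i y)" for xs
  define M where "M xs = [((-1 :: int) ^ card S)] \<cdot>\<^bsub>D n\<^esub> dD (n - 1) (W xs i y)" for xs
  have len: "length xs = card S" and sub: "set xs \<subseteq> N" and ne: "xs \<noteq> []" if "xs \<in> ?P" for xs
    using that fin S by (auto simp: length_finite_permutations_of_set dest: permutations_of_setD)
  have Wxs: "W xs i y \<in> carrier (D (n - 1))" if "xs \<in> ?P" for xs
    using that S y n by (intro left_module_homD(1)[OF hom_W_permutations]) auto
  have L: "L xs \<in> carrier (D n)" if "xs \<in> ?P" for xs
    unfolding L_def using that S y n
    by (intro left_module_homD(1)[OF hom_W_permutations] closed_dD) auto
  have M: "M xs \<in> carrier (D n)" if "xs \<in> ?P" for xs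
    unfolding M_def using Wxs[OF that] by (intro Dn.add.int_pow_closed closed_dD) auto
  have \<Psi>: "\<Psi> us ts \<in> carrier (D n)"
    if "set us \<union> set ts \<subseteq> S" "us \<noteq> []" "ts \<noteq> []" "length us + length ts = card S" for us ts
    unfolding \<Psi>_def m_def using that S y n
    by (intro closed_W closed_\<alpha> closed_\<beta>) auto
  have f: "f us ts \<in> carrier (D n)"
    if "set us \<union> set ts \<subseteq> S" "us \<noteq> []" "ts \<noteq> []" "length us + length ts = card S" for us ts
    unfolding f_def using \<Psi>[OF that] by simp
  have split: "take j xs \<noteq> []" "drop j xs \<noteq> []" "set (take j xs) \<union> set (drop j xs) \<subseteq> S"
    "length (take j xs) + length (drop j xs) = card S" "length (take j xs) = j" "length (drop j xs) = card S - j"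
    if "xs \<in> ?P" "j \<in> ?J" for xs j
    using that len[OF that(1)] permutations_of_setD(1)[OF that(1)]
    by (auto dest: in_set_takeD in_set_dropD)
  have Wd: "W (drop j xs) i y \<in> carrier (D (n + int j - 1))" if "xs \<in> ?P" "j \<in> ?J" for xs j
    using split[OF that] S y n that by (intro closed_W) auto
  have homWt: "W (take j xs) (n + int j - 1) \<in> left_module_hom R (D (n + int j - 1)) (D n)"
    if "xs \<in> ?P" "j \<in> ?J" for xs j
    using split[OF that] S y n that by (intro hom_W) auto
  have V: "V j xs \<in> carrier (D n)" if "xs \<in> ?P" "j \<in> ?J" for xs j
    unfolding V_def using left_module_homD(1)[OF homWt Wd] that by blast
  have \<Psi>': "\<Psi> (take j xs) (drop j xs) \<in> carrier (D n)" if "xs \<in> ?P" "j \<in> ?J" for xs j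
    using \<Psi> split[OF that] by blast
  have f': "f (take j xs) (drop j xs) \<in> carrier (D n)" if "xs \<in> ?P" "j \<in> ?J" for xs j
    using f split[OF that] by blast
  \<comment> \<open>The \<open>\<alpha> \<beta>\<close> part takes the Leibniz sign into
    \<open>f\<close>, since \<open>c j\<close> is -1 to the length of the right word. The identity
    part keeps \<open>- c j\<close> outside the list sign, to be pulled out of the sum over
    orderings.\<close>
  have W\<delta>: "[list_sign xs] \<cdot>\<^bsub>D n\<^esub> ([c j] \<cdot>\<^bsub>D n\<^esub>
      W (take j xs) (n + int j - 1) (\<delta> (n + int j - 1) (W (drop j xs) i y))) =
      f (take j xs) (drop j xs) \<oplus>\<^bsub>D n\<^esub> [(- c j)] \<cdot>\<^bsub>D n\<^esub> ([list_sign xs] \<cdot>\<^bsub>D n\<^esub> V j xs)"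
    if "xs \<in> ?P" "j \<in> ?J" for xs j
  proof -
    interpret w: abelian_group_hom "D (n + int j - 1)" "D n" "W (take j xs) (n + int j - 1)"
      by (rule left_module_hom_abelian_group_hom[OF module_D module_D homWt[OF that]])
    have "W (take j xs) (n + int j - 1) (\<delta> (n + int j - 1) (W (drop j xs) i y)) =
        \<Psi> (take j xs) (drop j xs) \<ominus>\<^bsub>D n\<^esub> V j xs"
      unfolding \<delta>_def V_def \<Psi>_def m_def split(5)[OF that] using Wd[OF that]
      by (intro w.hom_minus closed_\<alpha> closed_\<beta>)
    moreover have "[list_sign xs] \<cdot>\<^bsub>D n\<^esub> ([c j] \<cdot>\<^bsub>D n\<^esub> (P \<ominus>\<^bsub>D n\<^esub> Q)) =
        [(list_sign xs * c j)] \<cdot>\<^bsub>D n\<^esub> P \<oplus>\<^bsub>D n\<^esub> [(- c j)] \<cdot>\<^bsub>D n\<^esub> ([list_sign xs] \<cdot>\<^bsub>D n\<^esub> Q)"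
      if "P \<in> carrier (D n)" "Q \<in> carrier (D n)" for P Q
      using that by (simp add: a_minus_def Dn.add.int_pow_distrib Dn.add_pow_add_pow
        Dn.add_pow_uminus Dn.add.int_pow_inv mult.commute)
    ultimately show ?thesis
      unfolding f_def using \<Psi>' V that split(6)[OF that] by (simp add: c_def)
  qed
  have leib: "[list_sign xs] \<cdot>\<^bsub>D n\<^esub> L xs \<oplus>\<^bsub>D n\<^esub> [list_sign xs] \<cdot>\<^bsub>D n\<^esub> M xs \<oplus>\<^bsub>D n\<^esub>
      ((\<Oplus>\<^bsub>D n\<^esub>j\<in>?J. f (take j xs) (drop j xs)) \<oplus>\<^bsub>D n\<^esub>
       (\<Oplus>\<^bsub>D n\<^esub>j\<in>?J. [(- c j)] \<cdot>\<^bsub>D n\<^esub> ([list_sign xs] \<cdot>\<^bsub>D n\<^esub> V j xs))) = \<zero>\<^bsub>D n\<^esub>" if xs: "xs \<in> ?P" for xs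
  proof -
    let ?E = "\<lambda>j. [c j] \<cdot>\<^bsub>D n\<^esub> W (take j xs) (n + int j - 1) (\<delta> (n + int j - 1) (W (drop j xs) i y))"
    have E: "?E j \<in> carrier (D n)" if "j \<in> ?J" for j
      using left_module_homD(1)[OF homWt[OF xs that] closed_\<delta>[OF Wd[OF xs that]]] by simp
    have "L xs \<oplus>\<^bsub>D n\<^esub> M xs \<oplus>\<^bsub>D n\<^esub> (\<Oplus>\<^bsub>D n\<^esub>j\<in>?J. ?E j) = \<zero>\<^bsub>D n\<^esub>"
      using W_leibniz[OF ne[OF xs] sub[OF xs] y, of n] len[OF xs] n
      by (simp add: L_def M_def c_def)
    then have "[list_sign xs] \<cdot>\<^bsub>D n\<^esub> (L xs \<oplus>\<^bsub>D n\<^esub> M xs \<oplus>\<^bsub>D n\<^esub> (\<Oplus>\<^bsub>D n\<^esub>j\<in>?J. ?E j)) = \<zero>\<^bsub>D n\<^esub>"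
      by simp
    moreover have "finsum (D n) ?E ?J \<in> carrier (D n)" using E by (intro Dn.finsum_closed) auto
    moreover have "[list_sign xs] \<cdot>\<^bsub>D n\<^esub> finsum (D n) ?E ?J = (\<Oplus>\<^bsub>D n\<^esub>j\<in>?J. [list_sign xs] \<cdot>\<^bsub>D n\<^esub> ?E j)"
      using E by (intro Dn.add_pow_finsum) auto
    moreover have "\<dots> = (\<Oplus>\<^bsub>D n\<^esub>j\<in>?J. f (take j xs) (drop j xs) \<oplus>\<^bsub>D n\<^esub>
        [(- c j)] \<cdot>\<^bsub>D n\<^esub> ([list_sign xs] \<cdot>\<^bsub>D n\<^esub> V j xs))"
      using W\<delta>[OF xs] f'[OF xs] V[OF xs] by (intro Dn.finsum_cong' refl) auto
    moreover have "\<dots> = (\<Oplus>\<^bsub>D n\<^esub>j\<in>?J. f (take j xs) (drop j xs)) \<oplus>\<^bsub>D n\<^esub>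
       (\<Oplus>\<^bsub>D n\<^esub>j\<in>?J. [(- c j)] \<cdot>\<^bsub>D n\<^esub> ([list_sign xs] \<cdot>\<^bsub>D n\<^esub> V j xs))"
      using f'[OF xs] V[OF xs] by (intro Dn.finsum_addf) auto
    ultimately show ?thesis
      using L[OF xs] M[OF xs] by (simp only: Dn.add.int_pow_distrib Dn.a_closed)
  qed
  let ?A = "\<Oplus>\<^bsub>D n\<^esub>xs\<in>?P. [list_sign xs] \<cdot>\<^bsub>D n\<^esub> L xs"
  let ?B = "\<Oplus>\<^bsub>D n\<^esub>xs\<in>?P. [list_sign xs] \<cdot>\<^bsub>D n\<^esub> M xs"
  let ?F = "\<Oplus>\<^bsub>D n\<^esub>xs\<in>?P. \<Oplus>\<^bsub>D n\<^esub>j\<in>?J. f (take j xs) (drop j xs)"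
  let ?V = "\<Oplus>\<^bsub>D n\<^esub>xs\<in>?P. \<Oplus>\<^bsub>D n\<^esub>j\<in>?J. [(- c j)] \<cdot>\<^bsub>D n\<^esub> ([list_sign xs] \<cdot>\<^bsub>D n\<^esub> V j xs)"
  have F: "?F \<in> carrier (D n)" using f' by (auto intro!: Dn.finsum_closed)
  have "?A \<oplus>\<^bsub>D n\<^esub> ?B \<oplus>\<^bsub>D n\<^esub> (?F \<oplus>\<^bsub>D n\<^esub> ?V) =
    (\<Oplus>\<^bsub>D n\<^esub>xs\<in>?P. [list_sign xs] \<cdot>\<^bsub>D n\<^esub> L xs \<oplus>\<^bsub>D n\<^esub> [list_sign xs] \<cdot>\<^bsub>D n\<^esub> M xs \<oplus>\<^bsub>D n\<^esub>
      ((\<Oplus>\<^bsub>D n\<^esub>j\<in>?J. f (take j xs) (drop j xs)) \<oplus>\<^bsub>D n\<^esub>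
       (\<Oplus>\<^bsub>D n\<^esub>j\<in>?J. [(- c j)] \<cdot>\<^bsub>D n\<^esub> ([list_sign xs] \<cdot>\<^bsub>D n\<^esub> V j xs))))"
  proof -
    have 1: "(\<lambda>xs. [list_sign xs] \<cdot>\<^bsub>D n\<^esub> L xs) \<in> ?P \<rightarrow> carrier (D n)"
      "(\<lambda>xs. [list_sign xs] \<cdot>\<^bsub>D n\<^esub> M xs) \<in> ?P \<rightarrow> carrier (D n)"
      "(\<lambda>xs. \<Oplus>\<^bsub>D n\<^esub>j\<in>?J. f (take j xs) (drop j xs)) \<in> ?P \<rightarrow> carrier (D n)"
      "(\<lambda>xs. \<Oplus>\<^bsub>D n\<^esub>j\<in>?J. [(- c j)] \<cdot>\<^bsub>D n\<^esub> ([list_sign xs] \<cdot>\<^bsub>D n\<^esub> V j xs)) \<in> ?P \<rightarrow> carrier (D n)"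
      using L M f' V by (auto intro!: Dn.finsum_closed)
    have 2: "(\<lambda>xs. [list_sign xs] \<cdot>\<^bsub>D n\<^esub> L xs \<oplus>\<^bsub>D n\<^esub> [list_sign xs] \<cdot>\<^bsub>D n\<^esub> M xs) \<in> ?P \<rightarrow> carrier (D n)"
      "(\<lambda>xs. (\<Oplus>\<^bsub>D n\<^esub>j\<in>?J. f (take j xs) (drop j xs)) \<oplus>\<^bsub>D n\<^esub>
        (\<Oplus>\<^bsub>D n\<^esub>j\<in>?J. [(- c j)] \<cdot>\<^bsub>D n\<^esub> ([list_sign xs] \<cdot>\<^bsub>D n\<^esub> V j xs))) \<in> ?P \<rightarrow> carrier (D n)"
      using 1 by (simp_all add: Pi_iff)
    show ?thesis
      by (simp only: Dn.finsum_addf[OF 2] Dn.finsum_addf[OF 1(1,2)] Dn.finsum_addf[OF 1(3,4)])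
  qed
  also have "\<dots> = \<zero>\<^bsub>D n\<^esub>"
    using leib by (rule Dn.add.finprod_one_eqI)
  finally have total: "?A \<oplus>\<^bsub>D n\<^esub> ?B \<oplus>\<^bsub>D n\<^esub> (?F \<oplus>\<^bsub>D n\<^esub> ?V) = \<zero>\<^bsub>D n\<^esub>" .
  \<comment> \<open>The identity words cancel among orderings with the same cut, so the cut has to
    become the outer index.\<close>
  have "?V = (\<Oplus>\<^bsub>D n\<^esub>j\<in>?J. \<Oplus>\<^bsub>D n\<^esub>xs\<in>?P. [(- c j)] \<cdot>\<^bsub>D n\<^esub> ([list_sign xs] \<cdot>\<^bsub>D n\<^esub> V j xs))"
    using V by (intro Dn.finsum_swap) auto
  also have "\<dots> = \<zero>\<^bsub>D n\<^esub>"
  proof (rule Dn.add.finprod_one_eqI)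
    fix j assume j: "j \<in> ?J"
    have "(\<Oplus>\<^bsub>D n\<^esub>xs\<in>?P. [(- c j)] \<cdot>\<^bsub>D n\<^esub> ([list_sign xs] \<cdot>\<^bsub>D n\<^esub> V j xs)) =
        [(- c j)] \<cdot>\<^bsub>D n\<^esub> (\<Oplus>\<^bsub>D n\<^esub>xs\<in>?P. [list_sign xs] \<cdot>\<^bsub>D n\<^esub> V j xs)"
      using V j by (intro Dn.add_pow_finsum[symmetric]) auto
    also have "(\<Oplus>\<^bsub>D n\<^esub>xs\<in>?P. [list_sign xs] \<cdot>\<^bsub>D n\<^esub> V j xs) = \<zero>\<^bsub>D n\<^esub>"
      unfolding V_def using j S(1) y n by (intro finsum_W_take_drop_eq_zero) auto
    finally show "(\<Oplus>\<^bsub>D n\<^esub>xs\<in>?P. [(- c j)] \<cdot>\<^bsub>D n\<^esub> ([list_sign xs] \<cdot>\<^bsub>D n\<^esub> V j xs)) = \<zero>\<^bsub>D n\<^esub>"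
      by simp
  qed
  finally have V0: "?V = \<zero>\<^bsub>D n\<^esub>" .
  have A: "?A = antisym S (i + 1) (dD i y)"
  proof -
    have "i + 1 + 1 - int (card S) = n" using n by simp
    then show ?thesis by (simp only: antisym_def L_def)
  qed
  have B: "?B = [((-1 :: int) ^ card S)] \<cdot>\<^bsub>D n\<^esub> dD (n - 1) (antisym S i y)"
  proof -
    interpret d: abelian_group_hom "D (n - 1)" "D n" "dD (n - 1)" by (rule group_hom_dD) simp
    interpret Dn1: abelian_group "D (n - 1)" by (rule group_D)
    have n1: "i + 1 - int (card S) = n - 1" using n by simp
    have "dD (n - 1) (antisym S i y) = (\<Oplus>\<^bsub>D n\<^esub>xs\<in>?P. dD (n - 1) ([list_sign xs] \<cdot>\<^bsub>D (n - 1)\<^esub> W xs i y))"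
      unfolding antisym_def n1 using Wxs by (intro d.hom_finsum) auto
    also have "\<dots> = (\<Oplus>\<^bsub>D n\<^esub>xs\<in>?P. [list_sign xs] \<cdot>\<^bsub>D n\<^esub> dD (n - 1) (W xs i y))"
      using Wxs by (intro Dn.finsum_cong' refl) (auto simp: d.hom_add_pow)
    finally have "[((-1 :: int) ^ card S)] \<cdot>\<^bsub>D n\<^esub> dD (n - 1) (antisym S i y) =
        (\<Oplus>\<^bsub>D n\<^esub>xs\<in>?P. [((-1 :: int) ^ card S)] \<cdot>\<^bsub>D n\<^esub> ([list_sign xs] \<cdot>\<^bsub>D n\<^esub> dD (n - 1) (W xs i y)))"
      using Wxs by (simp only:) (intro Dn.add_pow_finsum, auto)
    also have "\<dots> = ?B"
      using Wxs by (intro Dn.finsum_cong' refl)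
        (auto simp: M_def Dn.add_pow_add_pow mult.commute)
    finally show ?thesis ..
  qed
  have "?F = (\<Oplus>\<^bsub>D n\<^esub>T\<in>Pow S - {{}, S}. \<Oplus>\<^bsub>D n\<^esub>us\<in>permutations_of_set (S - T).
      \<Oplus>\<^bsub>D n\<^esub>ts\<in>permutations_of_set T. f us ts)"
    using fin f by (rule Dn.finsum_deconcatenation)
  also have "\<dots> = (\<Oplus>\<^bsub>D n\<^esub>T\<in>Pow S - {{}, S}. [((-1 :: int) ^ card T * inv_sign (S - T) T)] \<cdot>\<^bsub>D n\<^esub>
      antisym (S - T) (i + 1 - int (card T))
        (\<alpha> (i + 1 - int (card T)) (\<beta> (i + 1 - int (card T)) (antisym T i y))))"
  proof (rule Dn.finsum_cong'[OF refl])
    have deg: "n = i + 1 - int (card T) + 1 - int (card (S - T))" if "T \<subseteq> S" for T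
      using that fin n card_mono[OF fin that] by (simp add: card_Diff_subset finite_subset[OF that])
    show "(\<lambda>T. [((-1 :: int) ^ card T * inv_sign (S - T) T)] \<cdot>\<^bsub>D n\<^esub>
      antisym (S - T) (i + 1 - int (card T))
        (\<alpha> (i + 1 - int (card T)) (\<beta> (i + 1 - int (card T)) (antisym T i y)))) \<in> Pow S - {{}, S} \<rightarrow> carrier (D n)"
      using S y deg by (intro funcsetI Dn.add.int_pow_closed closed_antisym closed_\<alpha> closed_\<beta>) auto
    fix T assume "T \<in> Pow S - {{}, S}"
    then have T: "T \<subseteq> S" "T \<noteq> {}" "S - T \<noteq> {}" by auto
    have "(\<Oplus>\<^bsub>D n\<^esub>us\<in>permutations_of_set (S - T). \<Oplus>\<^bsub>D n\<^esub>ts\<in>permutations_of_set T. f us ts) =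
      (\<Oplus>\<^bsub>D n\<^esub>us\<in>permutations_of_set (S - T). \<Oplus>\<^bsub>D n\<^esub>ts\<in>permutations_of_set T.
      [(list_sign (us @ ts) * (-1) ^ length ts)] \<cdot>\<^bsub>D n\<^esub> W us (i + 1 - int (card T))
        (\<alpha> (i + 1 - int (card T)) (\<beta> (i + 1 - int (card T)) (W ts i y))))"
    proof -
      have m: "m us = i + 1 - int (card T)" if "us \<in> permutations_of_set (S - T)" for us
        using that fin deg[OF T(1)] by (simp add: m_def length_finite_permutations_of_set)
      have "f us ts \<in> carrier (D n)"
        if "us \<in> permutations_of_set (S - T)" "ts \<in> permutations_of_set T" for us ts
      proof (rule f)
        show "length us + length ts = card S"
          using that fin T(1) card_mono[OF fin T(1)]
          by (simp add: length_finite_permutations_of_set finite_subset[OF T(1)] card_Diff_subset)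
      qed (use that T in \<open>auto simp: permutations_of_set_def\<close>)
      then show ?thesis
        using m by (intro Dn.finsum_cong' refl) (auto simp: f_def \<Psi>_def intro!: Dn.finsum_closed)
    qed
    also have "\<dots> = [((-1 :: int) ^ card T * inv_sign (S - T) T)] \<cdot>\<^bsub>D n\<^esub>
      antisym (S - T) (i + 1 - int (card T))
        (\<alpha> (i + 1 - int (card T)) (\<beta> (i + 1 - int (card T)) (antisym T i y)))"
      using S T y deg[OF T(1)] by (intro antisym_\<alpha>\<beta>_antisym[symmetric]) auto
    finally show "(\<Oplus>\<^bsub>D n\<^esub>us\<in>permutations_of_set (S - T). \<Oplus>\<^bsub>D n\<^esub>ts\<in>permutations_of_set T. f us ts) = \<dots>" .
  qed
  finally show ?thesis
    using total F unfolding V0 A B by (simp only: Dn.r_zero)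
qed

section \<open>The quadratic relation between the transferred maps\<close>

text \<open>The maps \<open>d\<close>, \<open>f\<^sub>k\<close> and \<open>H\<^sub>S\<close> of the special diagram, indexed uniformly by \<open>S\<close>.\<close>

definition transferred :: "'n set \<Rightarrow> ('c, 'c) graded_map" where
  "transferred S i x =
     (if S = {} then dC i x else \<beta> (i + 1 - int (card S)) (antisym S i (\<alpha> i x)))"

lemma transferred_nonempty:
  assumes "S \<noteq> {}" "n = i + 1 - int (card S)"
  shows "transferred S i x = \<beta> n (antisym S i (\<alpha> i x))"
  using assms by (simp add: transferred_def)

lemma hom_transferred:
  assumes "S \<subseteq> N" "j = i + 1 - int (card S)"
  shows "transferred S i \<in> left_module_hom R (C i) (C j)"
proof (cases "S = {}")
  case True
  then have "transferred S i = dC i" by (simp add: fun_eq_iff transferred_def)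
  then show ?thesis using hom_dC True assms by simp
next
  case False
  then have "transferred S i = (\<lambda>x. \<beta> j (antisym S i (\<alpha> i x)))"
    using assms by (intro ext transferred_nonempty)
  then show ?thesis
    using left_module_hom_comp[OF left_module_hom_comp[OF hom_\<alpha> hom_antisym] hom_\<beta>] assms False
    by auto
qed

lemmas closed_transferred = left_module_homD(1)[OF hom_transferred]
lemmas group_hom_transferred = left_module_hom_abelian_group_hom[OF module_C module_C hom_transferred]

text \<open>For nonempty \<open>S\<close> this is \<open>antisym_leibniz\<close> at
  \<open>\<alpha> i x\<close> with \<open>\<beta>\<close> applied: as \<open>\<alpha>\<close> and
  \<open>\<beta>\<close> are cochain maps, \<open>T = {}\<close> and \<open>T = S\<close> give the
  terms with \<open>d\<close>, and every other \<open>T\<close> gives a composite with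
  \<open>\<alpha> \<beta>\<close> in the middle. The power of -1 is what remains of the factors
  \<open>(-1)^(ab)\<close> in the totalisation.\<close>

lemma finsum_transferred_transferred:
  assumes S: "S \<subseteq> N" and x: "x \<in> carrier (C i)" and n: "n = i + 2 - int (card S)"
  shows "(\<Oplus>\<^bsub>C n\<^esub>T\<in>Pow S. [((-1 :: int) ^ (card S * card T) * inv_sign T (S - T))] \<cdot>\<^bsub>C n\<^esub>
    transferred (S - T) (i + 1 - int (card T)) (transferred T i x)) = \<zero>\<^bsub>C n\<^esub>"
proof -
  interpret Cn: abelian_group "C n" by (rule group_C)
  interpret Dn: abelian_group "D n" by (rule group_D)
  interpret \<beta>: abelian_group_hom "D n" "C n" "\<beta> n" by (rule group_hom_\<beta>)
  define g where "g T = [((-1 :: int) ^ (card S * card T) * inv_sign T (S - T))] \<cdot>\<^bsub>C n\<^esub>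
    transferred (S - T) (i + 1 - int (card T)) (transferred T i x)" for T
  have fin: "finite S" using S finite_N by (rule finite_subset)
  have deg: "n = i + 1 - int (card T) + 1 - int (card (S - T))" if "T \<subseteq> S" for T
    using that fin n card_mono[OF fin that] by (simp add: card_Diff_subset finite_subset[OF that])
  have g: "g T \<in> carrier (C n)" if "T \<subseteq> S" for T
    unfolding g_def using that S x deg[OF that] by (intro Cn.add.int_pow_closed closed_transferred) auto
  show ?thesis
  \<comment> \<open>For empty \<open>S\<close> the extreme subsets \<open>{}\<close> and
    \<open>S\<close> coincide, and the relation is that \<open>d\<close> squares to zero.\<close>
  proof (cases "S = {}")
    case True
    have "transferred {} (i + 1) (transferred {} i x) = \<zero>\<^bsub>C n\<^esub>"
      using dC_dC[OF x] n True by (simp add: transferred_def)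
    then have "g {} = \<zero>\<^bsub>C n\<^esub>"
      using True by (simp add: g_def)
    then have "finsum (C n) g (Pow S) = \<zero>\<^bsub>C n\<^esub>" using True by simp
    then show ?thesis by (simp only: g_def[abs_def])
  next
    case False
    let ?Q = "Pow S - {{}, S}"
    define y where "y = \<alpha> i x"
    have y: "y \<in> carrier (D i)" unfolding y_def by (rule closed_\<alpha>[OF x])
    define q where "q T = [((-1 :: int) ^ card T * inv_sign (S - T) T)] \<cdot>\<^bsub>D n\<^esub>
      antisym (S - T) (i + 1 - int (card T))
        (\<alpha> (i + 1 - int (card T)) (\<beta> (i + 1 - int (card T)) (antisym T i y)))" for T
    have a0: "antisym S (i + 1) (dD i y) \<in> carrier (D n)"
      using S False y n by (intro closed_antisym closed_dD) auto
    have a1: "antisym S i y \<in> carrier (D (n - 1))"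
      using S False y n by (intro closed_antisym) auto
    have a2: "dD (n - 1) (antisym S i y) \<in> carrier (D n)"
      by (rule closed_dD[OF _ a1]) simp
    have q': "antisym (S - T) (i + 1 - int (card T))
        (\<alpha> (i + 1 - int (card T)) (\<beta> (i + 1 - int (card T)) (antisym T i y))) \<in> carrier (D n)"
      if "T \<in> ?Q" for T
      using that S y deg by (intro closed_antisym closed_\<alpha> closed_\<beta>) auto
    have q: "q T \<in> carrier (D n)" if "T \<in> ?Q" for T
      unfolding q_def using q'[OF that] by simp
    have sum_q: "finsum (D n) q ?Q \<in> carrier (D n)"
      using q by (intro Dn.finsum_closed) blast
    have g0: "g {} = \<beta> n (antisym S (i + 1) (dD i y))"
    proof -
      have "n = i + 1 + 1 - int (card S)" using n by simp
      then have "transferred S (i + 1) (dC i x) = \<beta> n (antisym S (i + 1) (\<alpha> (i + 1) (dC i x)))"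
        by (rule transferred_nonempty[OF False])
      then show ?thesis using a0 \<alpha>_dC[OF x] by (simp add: g_def transferred_def[of "{}"] y_def)
    qed
    have gS: "g S = \<beta> n ([((-1 :: int) ^ card S)] \<cdot>\<^bsub>D n\<^esub> dD (n - 1) (antisym S i y))"
    proof -
      have n1: "i + 1 - int (card S) = n - 1" using n by simp
      have "(-1 :: int) ^ (card S * card S) = (-1) ^ card S"
        by (cases "even (card S)") auto
      then have "g S = [((-1 :: int) ^ card S)] \<cdot>\<^bsub>C n\<^esub> dC (n - 1) (\<beta> (n - 1) (antisym S i y))"
        using transferred_nonempty[OF False n1[symmetric]]
        by (simp add: g_def n1 transferred_def[of "{}"] y_def)
      also have "dC (n - 1) (\<beta> (n - 1) (antisym S i y)) = \<beta> n (dD (n - 1) (antisym S i y))"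
        using \<beta>_dD[OF a1] by simp
      finally show ?thesis using a2 by (simp add: \<beta>.hom_add_pow)
    qed
    have gT: "g T = \<beta> n (q T)" if "T \<in> ?Q" for T
    proof -
      have T: "T \<subseteq> S" "T \<noteq> {}" "S - T \<noteq> {}" using that by auto
      \<comment> \<open>Since \<open>|S||T| = |S - T||T| + |T|^2\<close>, the power on the left
        contributes \<open>(-1)^|T|\<close> and, by \<open>inv_sign_swap\<close>, both shuffle signs
        of \<open>T\<close> and \<open>S - T\<close>; one of them cancels against the given
        \<open>inv_sign T (S - T)\<close>.\<close>
      have "(-1 :: int) ^ (card S * card T) * inv_sign T (S - T) = (-1) ^ card T * inv_sign (S - T) T"
      proof -
        have finT: "finite T" "finite (S - T)" using fin T finite_subset by auto
        have "card S = card (S - T) + card T"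
          using T fin finT by (simp add: card_Diff_subset card_mono)
        then have "(-1 :: int) ^ (card S * card T) =
            (-1) ^ (card (S - T) * card T) * (-1) ^ card T"
          by (cases "even (card T)") (simp_all add: power_add distrib_right)
        also have "(-1 :: int) ^ (card (S - T) * card T) = inv_sign (S - T) T * inv_sign T (S - T)"
          using finT by (subst inv_sign_swap) auto
        finally have "(-1 :: int) ^ (card S * card T) * inv_sign T (S - T) =
            (-1) ^ card T * inv_sign (S - T) T * (inv_sign T (S - T) * inv_sign T (S - T))"
          by (simp only: mult_ac)
        then show ?thesis by simp
      qed
      moreover have "transferred (S - T) (i + 1 - int (card T)) (transferred T i x) =
          \<beta> n (antisym (S - T) (i + 1 - int (card T))
            (\<alpha> (i + 1 - int (card T)) (\<beta> (i + 1 - int (card T)) (antisym T i y))))"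
        using transferred_nonempty[OF T(3) deg[OF T(1)]] transferred_nonempty[OF T(2) refl]
        by (simp add: y_def)
      ultimately show ?thesis
        unfolding g_def q_def using q'[OF that] by (simp only: \<beta>.hom_add_pow)
    qed
    have "Pow S = insert {} (insert S ?Q)" by auto
    then have "finsum (C n) g (Pow S) = finsum (C n) g (insert {} (insert S ?Q))" by (simp only:)
    also have "\<dots> = g {} \<oplus>\<^bsub>C n\<^esub> finsum (C n) g (insert S ?Q)"
      using g False fin by (intro Cn.finsum_insert) auto
    also have "finsum (C n) g (insert S ?Q) = g S \<oplus>\<^bsub>C n\<^esub> finsum (C n) g ?Q"
      using g fin by (intro Cn.finsum_insert) auto
    also have "finsum (C n) g ?Q = (\<Oplus>\<^bsub>C n\<^esub>T\<in>?Q. \<beta> n (q T))"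
      using gT q by (intro Cn.finsum_cong' refl) (blast intro: \<beta>.hom_closed)+
    also have "\<dots> = \<beta> n (finsum (D n) q ?Q)"
      using q by (intro \<beta>.hom_finsum[symmetric]) blast
    also have "g {} \<oplus>\<^bsub>C n\<^esub> (g S \<oplus>\<^bsub>C n\<^esub> \<beta> n (finsum (D n) q ?Q)) =
        \<beta> n (antisym S (i + 1) (dD i y) \<oplus>\<^bsub>D n\<^esub>
          [((-1 :: int) ^ card S)] \<cdot>\<^bsub>D n\<^esub> dD (n - 1) (antisym S i y) \<oplus>\<^bsub>D n\<^esub> finsum (D n) q ?Q)"
      unfolding g0 gS using a0 a2 sum_q by (simp add: Cn.a_assoc)
    also have "\<dots> = \<zero>\<^bsub>C n\<^esub>"
      unfolding q_def antisym_leibniz[OF S False y n] by simp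
    finally show ?thesis by (simp only: g_def[abs_def])
  qed
qed

section \<open>From the relation to the cube\<close>

lemma N_diagram_transferred:
  assumes "\<And>A B i x. A \<subseteq> B \<Longrightarrow> B \<subseteq> N \<Longrightarrow> x \<in> carrier (C i) \<Longrightarrow> F B A i x = transferred (B - A) i x"
  shows "N_diagram R N (\<lambda>A. C) F"
  unfolding N_diagram_def is_graded_module_def graded_hom_def
proof (intro conjI allI impI)
  fix A B :: "'n set" and i assume AB: "A \<subseteq> B \<and> B \<subseteq> N"
  then have "finite B" "finite A" using finite_N by (auto intro: finite_subset)
  then have deg: "i + (int (card A) - int (card B) + 1) = i + 1 - int (card (B - A))"
    using AB card_mono[of B A] by (simp add: card_Diff_subset)
  show "F B A i \<in> left_module_hom R (C i) (C (i + (int (card A) - int (card B) + 1)))"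
    using AB assms by (intro left_module_hom_cong[OF hom_transferred[OF _ deg] module_C]) auto
qed (rule module_C)

text \<open>The square of the differential vanishes entry by entry. Between \<open>A\<close> and
  \<open>B\<close> the intermediate sets are the \<open>A \<union> T\<close> with
  \<open>T \<subseteq> B - A\<close>, and up to a sign common to the whole entry their sum is
  \<open>finsum_transferred_transferred\<close>.\<close>

lemma special_N_cube_transferred:
  assumes F: "\<And>A B i x. A \<subseteq> B \<Longrightarrow> B \<subseteq> N \<Longrightarrow> x \<in> carrier (C i) \<Longrightarrow> F B A i x = transferred (B - A) i x"
  shows "special_N_cube R N (\<lambda>A. C) F"
  unfolding special_N_cube_def special_N_diagram_def homotopy_commutative_cube_def
proof (intro conjI allI impI ballI)
  fix A B A' B' :: "'n set" and i x
  assume "A \<subseteq> B \<and> B \<subseteq> N \<and> A' \<subseteq> B' \<and> B' \<subseteq> N \<and> B - A = B' - A'" "x \<in> carrier (C i)"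
  then show "F B A i x = F B' A' i x" by (simp add: F)
next
  fix l and v :: "'n set \<Rightarrow> 'c"
  assume v: "v \<in> carrier (Tot N (\<lambda>A. C) l)"
  have vA: "v A \<in> carrier (C (l - int (card A)))" if "A \<subseteq> N" for A
    using v that by (auto simp: Tot_def)
  have fin: "finite A" if "A \<subseteq> N" for A using that finite_N by (rule finite_subset)
  let ?e = "Tot_entry (\<lambda>A. C) F"
  have e_sub: "?e B A k x = [((-1 :: int) ^ (card A * card B) * incidence B A)] \<cdot>\<^bsub>C (k + 1 - int (card B))\<^esub>
      transferred (B - A) (k - int (card A)) x"
    if "A \<subseteq> B" "B \<subseteq> N" "x \<in> carrier (C (k - int (card A)))" for A B k x
    using F that by (simp add: Tot_entry_def)
  have e_not: "?e B A k x = \<zero>\<^bsub>C (k + 1 - int (card B))\<^esub>" if "\<not> A \<subseteq> B" for A B k x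
    using that by (simp add: Tot_entry_def)
  \<comment> \<open>Additivity of the entries is what allows the outer differential to be
    distributed over the sum that defines the inner one.\<close>
  have e_hom: "abelian_group_hom (C (k - int (card A))) (C (k + 1 - int (card B))) (?e B A k)"
    if "A \<subseteq> N" "B \<subseteq> N" for A B k
  proof (cases "A \<subseteq> B")
    case True
    let ?M = "C (k - int (card A))" and ?M' = "C (k + 1 - int (card B))"
    interpret M': abelian_group ?M' by (rule group_C)
    interpret M: abelian_group ?M by (rule group_C)
    have "k + 1 - int (card B) = k - int (card A) + 1 - int (card (B - A))"
      using True fin that card_mono[of B A] by (simp add: card_Diff_subset)
    then interpret t: abelian_group_hom ?M ?M' "transferred (B - A) (k - int (card A))"
      using that by (intro group_hom_transferred) auto
    show ?thesis
      using e_sub[OF True that(2)]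
      by (intro abelian_group_hom_additiveI group_C) (simp_all add: M'.add.int_pow_distrib)
  next
    case False
    interpret M': abelian_group "C (k + 1 - int (card B))" by (rule group_C)
    show ?thesis
      by (intro abelian_group_hom_additiveI group_C) (simp_all add: e_not[OF False])
  qed
  have e_closed: "?e B A k x \<in> carrier (C (k + 1 - int (card B)))"
    if "A \<subseteq> N" "B \<subseteq> N" "x \<in> carrier (C (k - int (card A)))" for A B k x
    using abelian_group_hom.hom_closed[OF e_hom] that by blast
  have entry: "(\<Oplus>\<^bsub>C (l + 1 + 1 - int (card B))\<^esub>M\<in>Pow N. ?e B M (l + 1) (?e M A l (v A))) =
      \<zero>\<^bsub>C (l + 1 + 1 - int (card B))\<^esub>" if A: "A \<subseteq> N" and B: "B \<subseteq> N" for A B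
  proof -
    define n where "n = l + 1 + 1 - int (card B)"
    interpret Cn: abelian_group "C n" by (rule group_C)
    let ?g = "\<lambda>M. ?e B M (l + 1) (?e M A l (v A))"
    have g: "?g M \<in> carrier (C n)" if "M \<subseteq> N" for M
      unfolding n_def using A B that vA by (intro e_closed) auto
    have g0: "?g M = \<zero>\<^bsub>C n\<^esub>" if "M \<subseteq> N" "\<not> (A \<subseteq> M \<and> M \<subseteq> B)" for M
    proof (cases "M \<subseteq> B")
      case True
      then have "\<not> A \<subseteq> M" using that(2) by simp
      then show ?thesis
        using abelian_group_hom.hom_zero[OF e_hom[OF that(1) B, of "l + 1"]]
        by (simp add: e_not n_def)
    next
      case False
      then show ?thesis by (simp add: e_not n_def)
    qed
    have "finsum (C n) ?g (Pow N) = \<zero>\<^bsub>C n\<^esub>"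
    proof (cases "A \<subseteq> B")
      case False
      then show ?thesis using g0 by (intro Cn.add.finprod_one_eqI) blast
    next
      case True
      define S where "S = B - A"
      define i where "i = l - int (card A)"
      \<comment> \<open>The part of the sign that is the same for all \<open>T\<close>: with
        \<open>m = |A| + |T|\<close> and \<open>b = |A| + |S|\<close>, the exponent
        \<open>m * b + |A| * m\<close> is congruent to \<open>|A||S| + |S||T|\<close> modulo 2, and
        \<open>inv_sign S B\<close> is the constant factor from
        \<open>incidence_mult\<close>.\<close>
      define \<epsilon> where "\<epsilon> = (-1 :: int) ^ (card A * card S) * inv_sign S B"
      have x: "v A \<in> carrier (C i)" unfolding i_def by (rule vA[OF A])
      have S: "S \<subseteq> N" using B by (auto simp: S_def)
      have finS: "finite S" "finite A" "finite B" using fin A B S by auto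
      have cardB: "card B = card A + card S"
        using True finS card_mono[of B A] by (simp add: S_def card_Diff_subset)
      have n: "n = i + 2 - int (card S)" by (simp add: n_def i_def cardB)
      let ?k = "\<lambda>T. [((-1 :: int) ^ (card S * card T) * inv_sign T (S - T))] \<cdot>\<^bsub>C n\<^esub>
        transferred (S - T) (i + 1 - int (card T)) (transferred T i (v A))"
      have summand: "?g (A \<union> T) = [\<epsilon>] \<cdot>\<^bsub>C n\<^esub> ?k T \<and> ?k T \<in> carrier (C n)" if T: "T \<subseteq> S" for T
      proof -
        let ?M = "A \<union> T"
        have finT: "finite T" using T finS finite_subset by blast
        have sub: "A \<subseteq> ?M" "?M \<subseteq> B" "?M \<subseteq> N" "T \<subseteq> N" "?M - A = T" "B - ?M = S - T"
          using T True B by (auto simp: S_def)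
        have cM: "card ?M = card A + card T"
          using T finS finT by (intro card_Un_disjoint) (auto simp: S_def)
        have cST: "int (card (S - T)) = int (card S) - int (card T)"
          using T finS finT card_mono[of S T] by (simp add: card_Diff_subset)
        define m where "m = i + 1 - int (card T)"
        have m: "l + 1 - int (card ?M) = m" by (simp add: m_def i_def cM)
        interpret t: abelian_group_hom "C m" "C n" "transferred (S - T) m"
          using S n cST by (intro group_hom_transferred) (auto simp: m_def)
        interpret Cm: abelian_group "C m" by (rule group_C)
        have tx: "transferred T i (v A) \<in> carrier (C m)"
          using sub x by (intro closed_transferred) (auto simp: m_def)
        define c1 where "c1 = (-1 :: int) ^ (card A * card ?M) * incidence ?M A"
        define c2 where "c2 = (-1 :: int) ^ (card ?M * card B) * incidence B ?M"
        have "?e ?M A l (v A) = [c1] \<cdot>\<^bsub>C m\<^esub> transferred T i (v A)"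
          using e_sub[OF sub(1,3), of "v A" l] x unfolding sub(5) m c1_def i_def by simp
        moreover have "?e B ?M (l + 1) z = [c2] \<cdot>\<^bsub>C n\<^esub> transferred (S - T) m z"
          if "z \<in> carrier (C m)" for z
          using e_sub[OF sub(2) B, of z "l + 1"] that unfolding sub(6) m c2_def n_def by simp
        ultimately have "?g ?M = [(c2 * c1)] \<cdot>\<^bsub>C n\<^esub> transferred (S - T) m (transferred T i (v A))"
          using tx by (simp add: t.hom_add_pow Cn.add_pow_add_pow)
        also have "c2 * c1 = \<epsilon> * ((-1) ^ (card S * card T) * inv_sign T (S - T))"
        proof -
          have "(-1 :: int) ^ (card ?M * card B) * (-1) ^ (card A * card ?M) =
              (-1) ^ (card A * card S) * (-1) ^ (card S * card T)"
          proof -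
            have "card ?M * card B + card A * card ?M =
                2 * (card A * card A + card A * card T) + (card A * card S + card S * card T)"
              unfolding cM cardB by (simp add: algebra_simps)
            then show ?thesis unfolding power_add[symmetric] by (simp add: power_add power_mult)
          qed
          moreover have "incidence B ?M * incidence ?M A = inv_sign S B * inv_sign T (S - T)"
            using incidence_mult[OF finS(3) sub(1,2)] unfolding sub(5,6) S_def[symmetric] .
          moreover have "c2 * c1 = ((-1) ^ (card ?M * card B) * (-1) ^ (card A * card ?M)) *
              (incidence B ?M * incidence ?M A)"
            by (simp only: c1_def c2_def mult_ac)
          ultimately show ?thesis by (simp only: \<epsilon>_def mult_ac)
        qed
        finally show ?thesis
          using tx by (simp add: Cn.add_pow_add_pow m_def[symmetric])
      qed
      have "finsum (C n) ?g (Pow N) = finsum (C n) ?g ((\<union>) A ` Pow S)"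
      proof (rule Cn.add.finprod_mono_neutral_cong_right)
        show "(\<union>) A ` Pow S \<subseteq> Pow N" using A S by auto
        fix M assume M: "M \<in> Pow N - (\<union>) A ` Pow S"
        have "M \<in> (\<union>) A ` Pow S" if "A \<subseteq> M" "M \<subseteq> B"
          using that by (intro image_eqI[of _ _ "M - A"]) (auto simp: S_def)
        then show "?g M = \<zero>\<^bsub>C n\<^esub>" using M g0 by blast
      qed (use g finite_N in auto)
      also have "\<dots> = (\<Oplus>\<^bsub>C n\<^esub>T\<in>Pow S. ?g (A \<union> T))"
      proof (rule Cn.finsum_reindex)
        show "inj_on ((\<union>) A) (Pow S)" by (auto simp: inj_on_def S_def)
      qed (use g A S in auto)
      also have "\<dots> = (\<Oplus>\<^bsub>C n\<^esub>T\<in>Pow S. [\<epsilon>] \<cdot>\<^bsub>C n\<^esub> ?k T)"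
        using summand by (intro Cn.finsum_cong' refl) auto
      also have "\<dots> = [\<epsilon>] \<cdot>\<^bsub>C n\<^esub> (\<Oplus>\<^bsub>C n\<^esub>T\<in>Pow S. ?k T)"
        using summand by (intro Cn.add_pow_finsum[symmetric]) auto
      also have "\<dots> = \<zero>\<^bsub>C n\<^esub>"
        unfolding finsum_transferred_transferred[OF S x n] by simp
      finally show ?thesis .
    qed
    then show ?thesis unfolding n_def .
  qed
  show "Tot_diff N (\<lambda>A. C) F (l + 1) (Tot_diff N (\<lambda>A. C) F l v) = \<zero>\<^bsub>Tot N (\<lambda>A. C) (l + 2)\<^esub>"
  \<comment> \<open>Both sides are extensional families over \<open>Pow N\<close>, so it is enough
    to compare components, each of which is a row of the matrix product.\<close>
  proof (rule extensionalityI[of _ "Pow N"])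
    fix B assume "B \<in> Pow N"
    then have B: "B \<subseteq> N" by simp
    define n where "n = l + 1 + 1 - int (card B)"
    interpret Cn: abelian_group "C n" by (rule group_C)
    have closed: "?e B M (l + 1) (?e M A l (v A)) \<in> carrier (C n)" if "A \<subseteq> N" "M \<subseteq> N" for A M
      unfolding n_def using that B vA by (intro e_closed) auto
    have "Tot_diff N (\<lambda>A. C) F (l + 1) (Tot_diff N (\<lambda>A. C) F l v) B =
        (\<Oplus>\<^bsub>C n\<^esub>M\<in>Pow N. ?e B M (l + 1) (Tot_diff N (\<lambda>A. C) F l v M))"
      using B by (simp add: Tot_diff_def[of _ _ _ "l + 1"] n_def)
    also have "\<dots> = (\<Oplus>\<^bsub>C n\<^esub>M\<in>Pow N. \<Oplus>\<^bsub>C n\<^esub>A\<in>Pow N. ?e B M (l + 1) (?e M A l (v A)))"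
    proof (intro Cn.finsum_cong' refl)
      fix M assume "M \<in> Pow N"
      then have M: "M \<subseteq> N" by simp
      interpret e: abelian_group_hom "C (l + 1 - int (card M))" "C n" "?e B M (l + 1)"
        unfolding n_def by (rule e_hom[OF M B])
      show "?e B M (l + 1) (Tot_diff N (\<lambda>A. C) F l v M) =
          (\<Oplus>\<^bsub>C n\<^esub>A\<in>Pow N. ?e B M (l + 1) (?e M A l (v A)))"
        using M vA e_closed by (simp add: Tot_diff_def) (intro e.hom_finsum, auto)
    qed (use closed in \<open>auto intro!: Cn.finsum_closed\<close>)
    also have "\<dots> = (\<Oplus>\<^bsub>C n\<^esub>A\<in>Pow N. \<Oplus>\<^bsub>C n\<^esub>M\<in>Pow N. ?e B M (l + 1) (?e M A l (v A)))"
      using closed finite_N by (intro Cn.finsum_swap) auto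
    also have "\<dots> = \<zero>\<^bsub>C n\<^esub>"
      using entry[OF _ B, folded n_def] by (rule Cn.add.finprod_one_eqI) simp
    also have "\<dots> = \<zero>\<^bsub>Tot N (\<lambda>A. C) (l + 2)\<^esub> B"
      using B by (simp add: Tot_def n_def add.assoc)
    finally show "Tot_diff N (\<lambda>A. C) F (l + 1) (Tot_diff N (\<lambda>A. C) F l v) B =
        \<zero>\<^bsub>Tot N (\<lambda>A. C) (l + 2)\<^esub> B" .
  qed (simp_all add: Tot_diff_def Tot_def)
qed (simp_all add: N_diagram_transferred F)

end

section \<open>Identification of the given data with the transferred maps\<close>

theorem theoremI5p1:
  fixes R :: "('r, 'z) ring_scheme"
    and N :: "'n::linorder set"
    and C :: "('r, 'c) graded_module" and dC :: "('c, 'c) graded_map"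
    and D :: "('r, 'd) graded_module" and dD :: "('d, 'd) graded_map"
    and h :: "'n \<Rightarrow> ('d, 'd) graded_map"
    and \<alpha> :: "('c, 'd) graded_map" and \<beta> :: "('d, 'c) graded_map"
    and G :: "('d, 'd) graded_map"
    and f :: "'n \<Rightarrow> ('c, 'c) graded_map"
    and H :: "'n set \<Rightarrow> ('c, 'c) graded_map"
  assumes "ring R" and "finite N"
    and "cochain_complex R D dD"
    and "\<And>k. k \<in> N \<Longrightarrow> cochain_map R D dD D dD (h k)"
    and "\<And>k l i x. \<lbrakk>k \<in> N; l \<in> N; x \<in> carrier (D i)\<rbrakk> \<Longrightarrow> h k i (h l i x) = h l i (h k i x)"
    and "cochain_complex R C dC"
    and "cochain_map R C dC D dD \<alpha>"
    and "cochain_map R D dD C dC \<beta>"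
    and "cochain_homotopy R D dD D dD (\<lambda>i x. x) (\<lambda>i x. \<alpha> i (\<beta> i x)) G"
    and "\<And>k i x. \<lbrakk>k \<in> N; x \<in> carrier (C i)\<rbrakk> \<Longrightarrow> f k i x = \<beta> i (h k i (\<alpha> i x))"
    and "\<And>k l i x. \<lbrakk>k \<in> N; l \<in> N; k < l; x \<in> carrier (C i)\<rbrakk> \<Longrightarrow>
           H {k, l} i x =
             \<beta> (i - 1) (h k (i - 1) (G i (h l i (\<alpha> i x))) \<ominus>\<^bsub>D (i - 1)\<^esub>
                        h l (i - 1) (G i (h k i (\<alpha> i x))))"
    and "\<And>S i x. \<lbrakk>S \<subseteq> N; card S \<ge> 3; x \<in> carrier (C i)\<rbrakk> \<Longrightarrow>
           H S i x =
             \<beta> (i + 1 - int (card S))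
               (\<Oplus>\<^bsub>D (i + 1 - int (card S))\<^esub>\<sigma>\<in>{\<sigma>. \<sigma> permutes S}.
                  [sign \<sigma>] \<cdot>\<^bsub>D (i + 1 - int (card S))\<^esub>
                    hG_word h G (map \<sigma> (sorted_list_of_set S)) i (\<alpha> i x))"
  shows "special_N_cube R N (\<lambda>A. C) (special_maps dC f H)"
proof -
  interpret homotopy_transfer R N C dC D dD h \<alpha> \<beta> G
    using assms(2-9) by (rule homotopy_transfer.intro)
  \<comment> \<open>The three prescriptions for one, two and at least three indices are instances of
    one antisymmetrised formula. As \<open>f\<close> and \<open>H\<close> are prescribed on carriers
    only, the comparison is pointwise there.\<close>
  have maps: "special_maps dC f H B A i x = transferred (B - A) i x"
    if "A \<subseteq> B" "B \<subseteq> N" and x: "x \<in> carrier (C i)" for A B i x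
  proof -
    define S where "S = B - A"
    define y where "y = \<alpha> i x"
    define n where "n = i + 1 - int (card S)"
    interpret Dn: abelian_group "D n" by (rule group_D)
    have S: "S \<subseteq> N" using that by (auto simp: S_def)
    have fin: "finite S" using S finite_N by (rule finite_subset)
    have y: "y \<in> carrier (D i)" unfolding y_def by (rule closed_\<alpha>[OF x])
    have antisym: "antisym S i y = (\<Oplus>\<^bsub>D n\<^esub>xs\<in>permutations_of_set S. [list_sign xs] \<cdot>\<^bsub>D n\<^esub> W xs i y)"
      by (simp only: antisym_def n_def)
    have W: "W xs i y \<in> carrier (D n)" if "xs \<in> permutations_of_set S" "S \<noteq> {}" for xs
      using left_module_homD(1)[OF hom_W_permutations[OF S that(2,1) n_def] y] .
    consider "S = {}" | "card S = 1" | "card S = 2" | "card S \<ge> 3"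
      using fin by (metis card_0_eq Suc_leI le_neq_implies_less less_one not_less numeral_2_eq_2 numeral_3_eq_3 One_nat_def)
    then have "special_maps dC f H B A i x = transferred S i x"
    proof cases
      case 1
      then show ?thesis by (simp add: special_maps_def S_def[symmetric] transferred_def)
    next
      case 2
      then obtain k where k: "S = {k}" using card_1_singletonE by blast
      then have "n = i" and "k \<in> N" using S by (auto simp: n_def)
      have "h k i y \<in> carrier (D n)" using closed_h[OF \<open>k \<in> N\<close> y] \<open>n = i\<close> by simp
      then have "antisym S i y = h k i y"
        unfolding antisym by (simp add: k Dn.finsum_insert)
      then have "transferred S i x = \<beta> i (h k i (\<alpha> i x))"
        using transferred_nonempty[of S n i x] k \<open>n = i\<close> by (simp add: n_def y_def)
      also have "\<dots> = f k i x" using assms(10)[OF \<open>k \<in> N\<close> x] by simp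
      finally show ?thesis by (simp add: special_maps_def S_def[symmetric] k)
    next
      case 3
      then obtain a b where "S = {a, b}" "a \<noteq> b" by (meson card_2_iff)
      then obtain k l where kl: "S = {k, l}" "k < l"
        by (metis insert_commute linorder_neqE)
      have N: "k \<in> N" "l \<in> N" using S kl by auto
      have n: "n = i - 1" using 3 by (simp add: n_def)
      have P: "permutations_of_set S = {[k, l], [l, k]}"
        using kl by (simp add: permutations_of_set_doubleton)
      have W2: "W [a, b] i y = h a n (G i (h b i y))" for a b
        using n by simp
      have mem: "h k n (G i (h l i y)) \<in> carrier (D n)" "h l n (G i (h k i y)) \<in> carrier (D n)"
        using W[of "[k, l]"] W[of "[l, k]"] P kl(1) unfolding W2 by auto
      have sign: "list_sign [k, l] = 1" "list_sign [l, k] = - 1"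
        using kl(2) by (auto simp: inv_sign_def)
      \<comment> \<open>A pair has just two orderings, with signs 1 and -1, which gives the
        difference in the formula for \<open>H {k, l}\<close>.\<close>
      have "antisym S i y = h k n (G i (h l i y)) \<ominus>\<^bsub>D n\<^esub> h l n (G i (h k i y))"
      proof -
        have "antisym S i y = [list_sign [k, l]] \<cdot>\<^bsub>D n\<^esub> W [k, l] i y \<oplus>\<^bsub>D n\<^esub> [list_sign [l, k]] \<cdot>\<^bsub>D n\<^esub> W [l, k] i y"
          unfolding antisym P using mem kl(2) unfolding W2[symmetric]
          by (subst Dn.finsum_insert) (auto simp del: list_sign.simps hG_word.simps)
        then show ?thesis
          unfolding sign W2 using mem by (simp add: a_minus_def Dn.add_pow_uminus)
      qed
      moreover have "transferred S i x = \<beta> n (antisym S i y)"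
        unfolding y_def using kl by (intro transferred_nonempty) (auto simp: n_def)
      ultimately have "transferred S i x = H {k, l} i x"
        using assms(11)[OF N kl(2) x] by (simp add: n y_def)
      then show ?thesis
        using 3 by (auto simp: special_maps_def S_def[symmetric] kl(1))
    next
      case 4
      then have ne: "S \<noteq> {}" by auto
      let ?m = "\<lambda>\<sigma>. map \<sigma> (sorted_list_of_set S)"
      have bij: "inj_on ?m {\<sigma>. \<sigma> permutes S}" "permutations_of_set S = ?m ` {\<sigma>. \<sigma> permutes S}"
        using bij_betw_permutes_permutations_of_set[OF fin] by (simp_all add: bij_betw_def)
      \<comment> \<open>A permutation is replaced by the list of its values on the sorted elements
        of \<open>S\<close>, and its sign by the sign of that list.\<close>
      have "antisym S i y = (\<Oplus>\<^bsub>D n\<^esub>\<sigma>\<in>{\<sigma>. \<sigma> permutes S}. [list_sign (?m \<sigma>)] \<cdot>\<^bsub>D n\<^esub> W (?m \<sigma>) i y)"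
        unfolding antisym bij(2) using W[OF _ ne] unfolding bij(2)
        by (intro Dn.finsum_reindex[OF _ bij(1)]) auto
      also have "\<dots> = (\<Oplus>\<^bsub>D n\<^esub>\<sigma>\<in>{\<sigma>. \<sigma> permutes S}. [sign \<sigma>] \<cdot>\<^bsub>D n\<^esub> W (?m \<sigma>) i y)"
        using W[OF _ ne] fin unfolding bij(2)
        by (intro Dn.finsum_cong' refl) (auto simp: list_sign_map_permutes)
      finally have "H S i x = \<beta> n (antisym S i y)"
        using assms(12)[OF S 4 x] by (simp add: n_def y_def)
      also have "\<dots> = transferred S i x"
        unfolding y_def using ne by (intro transferred_nonempty[symmetric]) (auto simp: n_def)
      finally show ?thesis using 4 ne by (simp add: special_maps_def S_def[symmetric])
    qed
    then show ?thesis unfolding S_def .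
  qed
  show ?thesis by (rule special_N_cube_transferred) (rule maps)
qed

end
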